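(* Let $n\in\mathbb N_0$, $\alpha,\beta\in(-1,\infty)$, $\gamma\in\mathbb C$, $0<|q|<1$, $|t|<1-q$. Then $$\int_0^\infty{}_1\phi_2\!\left(\gamma;q^{\alpha+1},\gamma t;q,-xtq^{\alpha+1}\right)L_n^{(\beta)}(x;q)\frac{x^\beta}{(-x;q)_\infty}\,dx=\frac{-\left(tq^{\alpha-\beta}\right)^n(t;q)_\infty(\gamma;q)_n}{q^n(\gamma t;q)_\infty(q^{\alpha+1};q)_n}\;{}_2\phi_1\!\left(q^{\alpha-\beta},\gamma q^n;q^{\alpha+n+1};q,t\right)\,M_n(\beta),$$ where $$M_n(\beta)=\begin{cases}\dfrac{\pi(q^{-\beta};q)_\infty(q^{\beta+1};q)_n}{\sin(\pi\beta)(q;q)_\infty(q;q)_n},&\beta\in(-1,\infty)\setminus\mathbb N_0,\\[3mm]\dfrac{(q^{n+1};q)_\beta\log q}{q^{\beta(\beta+1)/2}},&\beta\in\mathbb N_0.\end{cases}$$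
   Context: Notation: $\mathbb N_0=\{0,1,2,\dots\}$, $(a;q)_0=1$, $(a;q)_n=\prod_{j=0}^{n-1}(1-aq^j)$, $(a;q)_\infty=\prod_{j\ge0}(1-aq^j)$, $(a_1,\dots,a_r;q)_n=\prod_i(a_i;q)_n$. The basic hypergeometric series, with upper parameters listed before the first semicolon and lower parameters before the second, is $${}_r\phi_s(a_1,\dots,a_r;b_1,\dots,b_s;q,z)=\sum_{k=0}^\infty\frac{(a_1,\dots,a_r;q)_k}{(q,b_1,\dots,b_s;q)_k}\left((-1)^kq^{\binom k2}\right)^{1+s-r}z^k.$$ The $q$-Laguerre polynomials are $$L_n^{(\alpha)}(x;q)=\frac{(q^{\alpha+1};q)_n}{(q;q)_n}\,{}_1\phi_1\!\left(q^{-n};q^{\alpha+1};q,-q^{n+\alpha+1}x\right).$$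
   Formalization: The base is taken as 0<q<1 instead of 0<|q|<1, since for −1<q<0 the weight has poles on (0,∞) and the integral diverges; and γtq^k≠1 is assumed for all k≥0, without which the lower parameter γt and the division by (γt;q)_∞ are undefined. *)

theory Defs
  imports "HOL-Analysis.Analysis"
begin

definition qpoch :: "'a :: comm_ring_1 \<Rightarrow> 'a \<Rightarrow> nat \<Rightarrow> 'a" where
  "qpoch a q n = (\<Prod>j<n. 1 - a * q ^ j)"

definition qpoch_inf :: "'a :: {real_normed_field, banach} \<Rightarrow> 'a \<Rightarrow> 'a" where
  "qpoch_inf a q = (\<Prod>j. 1 - a * q ^ j)"

definition qpochs :: "'a :: comm_ring_1 list \<Rightarrow> 'a \<Rightarrow> nat \<Rightarrow> 'a" where
  "qpochs as q k = (\<Prod>a\<leftarrow>as. qpoch a q k)"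

text \<open>The exponent \<open>1 + s - r\<close> may be negative, hence the integer power.\<close>

definition qhyper ::
    "'a :: {real_normed_field, banach} list \<Rightarrow> 'a list \<Rightarrow> 'a \<Rightarrow> 'a \<Rightarrow> 'a" where
  "qhyper as bs q z =
     (\<Sum>k. qpochs as q k / qpochs (q # bs) q k
        * ((-1) ^ k * q ^ (k choose 2)) powi (1 + int (length bs) - int (length as))
        * z ^ k)"

text \<open>The base \<open>q\<close> is meant to lie in the open unit interval: real powers of \<open>q\<close> are taken
  with \<open>powr\<close>.\<close>

definition qLaguerre :: "nat \<Rightarrow> real \<Rightarrow> real \<Rightarrow> real \<Rightarrow> real" where
  "qLaguerre n \<alpha> q x =
     qpoch (q powr (\<alpha> + 1)) q n / qpoch q q n
       * qhyper [q powr (- real n)] [q powr (\<alpha> + 1)] q (- (q powr (real n + \<alpha> + 1)) * x)"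

text \<open>For natural \<open>\<beta>\<close> the first expression is of the form \<open>0 / 0\<close>; the second is its limit.\<close>

definition qLaguerre_M :: "nat \<Rightarrow> real \<Rightarrow> real \<Rightarrow> real" where
  "qLaguerre_M n \<beta> q =
     (if \<beta> \<in> \<nat>
      then qpoch (q ^ (n + 1)) q (nat \<lfloor>\<beta>\<rfloor>) * ln q / q powr (\<beta> * (\<beta> + 1) / 2)
      else pi * qpoch_inf (q powr (- \<beta>)) q * qpoch (q powr (\<beta> + 1)) q n
             / (sin (pi * \<beta>) * qpoch_inf q q * qpoch q q n))"

end

theory Submission
  imports Defs
begin

text \<open>
  Write \<open>w(x) = x\<^sup>\<beta> / (-x;q)\<^sub>\<infinity>\<close> for the weight and \<open>\<mu>(s)\<close> for the integral of
  \<open>x\<^sup>s / (-x;q)\<^sub>\<infinity>\<close> over the positive half line.  The series \<open>\<^sub>1\<phi>\<^sub>2\<close> is integrated term by term,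
  which is legitimate because its coefficients decay like \<open>q\<^bsup>k(k-1)\<^esup>\<close> whereas the moments of
  the weight only grow like \<open>q\<^bsup>-k(k-1)/2\<^esup>\<close>, up to geometric factors.  Three facts then give the closed form.

  First, the moments.  Since \<open>(-x;q)\<^sub>\<infinity> = (1 + x) (-qx;q)\<^sub>\<infinity>\<close>, the substitution \<open>x \<mapsto> qx\<close> shows
  \<open>\<mu>(s+1) = (q\<^bsup>-s-1\<^esup> - 1) \<mu>(s)\<close>, so that only \<open>-1 < s \<le> 0\<close> has to be computed.  For \<open>s < 0\<close> the
  reciprocal of \<open>(-x;q)\<^sub>\<infinity>\<close> is expanded into partial fractions, each of which contributes the
  Beta integral \<open>\<pi> / sin (\<pi>c)\<close>, and Euler's series for \<open>(z;q)\<^sub>\<infinity>\<close> adds the contributions up.  For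
  \<open>s = 0\<close> the functional equation turns the integrand into \<open>(f(qx) - f(x)) / x\<close> with
  \<open>f(x) = 1/(-x;q)\<^sub>\<infinity>\<close>, a Frullani integral with value \<open>- ln q\<close>.  Both cases, and hence all moments,
  are \<open>- M\<^sub>0(s)\<close> with the constant \<open>M\<close> of the theorem (\<open>has_bochner_integral_qmoment\<close>).

  Secondly, by the \<open>q\<close>-Chu-Vandermonde sum the integral of \<open>x\<^sup>k L\<^sub>n(x) w(x)\<close> is \<open>\<mu>(\<beta>+k)\<close> times
  \<open>(q\<^bsup>-k\<^esup>;q)\<^sub>n / (q;q)\<^sub>n\<close> (\<open>has_bochner_integral_qLaguerre_power\<close>).  It vanishes for \<open>k < n\<close>, which
  expresses the orthogonality of the \<open>q\<close>-Laguerre polynomials, and after the shift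
  \<open>k = n + m\<close> the remaining terms form a \<open>\<^sub>2\<phi>\<^sub>2\<close> series (\<open>coefficient_identity\<close>).

  Thirdly, Jackson's transformation (\<open>jackson_transformation\<close>) converts that \<open>\<^sub>2\<phi>\<^sub>2\<close> into the
  \<open>\<^sub>2\<phi>\<^sub>1\<close> of the right-hand side.
\<close>

section \<open>Finite \<open>q\<close>-shifted factorials and the \<open>q\<close>-Chu-Vandermonde sum\<close>

lemma qpoch_0 [simp]: "qpoch a q 0 = 1"
  by (simp add: qpoch_def)

lemma qpoch_Suc: "qpoch a q (Suc n) = qpoch a q n * (1 - a * q ^ n)"
  by (simp add: qpoch_def)

lemma qpoch_add: "qpoch a q (m + n) = qpoch a q m * qpoch (a * q ^ m) q n"
  by (induction n) (simp_all add: qpoch_Suc power_add mult_ac)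

lemma qpoch_Suc_shift: "qpoch a q (Suc n) = (1 - a) * qpoch (a * q) q n"
  using qpoch_add[of a q 1 n] by (simp add: qpoch_Suc)

lemma qpoch_nonzero:
  fixes a q :: "'a :: field"
  shows "(\<And>k. a * q ^ k \<noteq> 1) \<Longrightarrow> qpoch a q n \<noteq> 0"
  by (auto simp: qpoch_def)

lemma qpoch_of_real:
  "qpoch (of_real a) (of_real q) n = (of_real (qpoch a q n) :: 'a :: {real_algebra_1, comm_ring_1})"
  by (simp add: qpoch_def)

lemma qpoch_inverse_power_eq_0:
  fixes q :: "'a :: field"
  assumes "q \<noteq> 0" "n < m"
  shows "qpoch (inverse q ^ n) q m = 0"
  using assms by (auto simp: qpoch_def power_inverse intro!: bexI[of _ n])

lemma choose_two_0 [simp]: "0 choose 2 = 0"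
  and choose_two_Suc: "Suc m choose 2 = (m choose 2) + m"
  by (simp_all add: numeral_2_eq_2)

text \<open>This is \<open>(q\<^bsup>-n\<^esup>;q)\<^sub>m = (-1)\<^sup>m q\<^bsup>m(m-1)/2 - nm\<^esup> (q;q)\<^sub>n / (q;q)\<^bsub>n-m\<^esub>\<close> without divisions.  It turns
  terminating series into sums over Gaussian binomial coefficients.\<close>

lemma qpoch_inverse_power:
  fixes q :: "'a :: field"
  assumes "q \<noteq> 0" "m \<le> n"
  shows "qpoch (inverse q ^ n) q m * q ^ (n * m) * qpoch q q (n - m)
       = (-1) ^ m * q ^ (m choose 2) * qpoch q q n"
  using assms(2)
proof (induction m)
  case (Suc m)
  define r where "r = n - Suc m"
  have n: "n = Suc (r + m)" using Suc.prems by (simp add: r_def)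
  have *: "(1 - inverse q ^ n * q ^ m) * q ^ n = - (q ^ m * (1 - q * q ^ r))"
    using assms(1) by (simp add: n field_simps power_add)
  have "qpoch (inverse q ^ n) q (Suc m) * q ^ (n * Suc m) * qpoch q q (n - Suc m)
     = qpoch (inverse q ^ n) q m * q ^ (n * m)
        * ((1 - inverse q ^ n * q ^ m) * q ^ n * qpoch q q r)"
    by (simp add: qpoch_Suc power_add r_def mult_ac)
  also have "\<dots> = - (q ^ m * (qpoch (inverse q ^ n) q m * q ^ (n * m) * qpoch q q (n - m)))"
    unfolding * by (simp add: n qpoch_Suc mult_ac Suc_diff_le)
  also have "\<dots> = (-1) ^ Suc m * q ^ (Suc m choose 2) * qpoch q q n"
    using Suc by (simp add: choose_two_Suc power_add mult_ac)
  finally show ?case .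
qed simp

text \<open>The \<open>q\<close>-Chu-Vandermonde sum with lower parameter \<open>b d\<close>, multiplied by \<open>(bd;q)\<^sub>n\<close>, which makes
  it a polynomial identity in \<open>b\<close> and \<open>d\<close>.  If \<open>S\<^sub>n(d)\<close> denotes the left-hand side, the Pascal rule
  \<open>1 - q\<^bsup>n+1\<^esup> = q\<^sup>m (1 - q\<^bsup>n+1-m\<^esup>) + (1 - q\<^sup>m)\<close> yields \<open>(1 - q\<^bsup>n+1\<^esup>) S\<^sub>n\<^sub>+\<^sub>1(d) = (1 - d) S\<^sub>n(d q)\<close>, because
  the two contributions to a term of \<open>S\<^sub>n(d q)\<close> carry the factors \<open>1 - b d q\<^sup>m\<close> and
  \<open>- d (1 - b q\<^sup>m)\<close>, whose sum is \<open>1 - d\<close>.\<close>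

lemma q_chu_vandermonde:
  fixes q b d :: "'a :: field"
  assumes "\<And>k. q ^ Suc k \<noteq> 1"
  shows "(\<Sum>m\<le>n. (-1) ^ m * q ^ (m choose 2) * d ^ m * qpoch b q m * qpoch (b * d * q ^ m) q (n - m)
            / (qpoch q q m * qpoch q q (n - m))) = qpoch d q n / qpoch q q n"
proof (induction n arbitrary: d)
  case (Suc n)
  have nz: "qpoch q q k \<noteq> 0" for k
    by (rule qpoch_nonzero) (use assms in auto)
  have nz1: "1 - q * q ^ k \<noteq> 0" for k
    using assms[of k] by auto
  define t where "t = (\<lambda>m. (-1) ^ m * q ^ (m choose 2) * d ^ m * qpoch b q m
      * qpoch (b * d * q ^ m) q (Suc n - m) / (qpoch q q m * qpoch q q (Suc n - m)))"
  define s where "s = (\<lambda>m. (-1) ^ m * q ^ (m choose 2) * (d * q) ^ m * qpoch b q m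
      * qpoch (b * (d * q) * q ^ m) q (n - m) / (qpoch q q m * qpoch q q (n - m)))"
  have split: "1 - q * q ^ n = q ^ m * (1 - q ^ (Suc n - m)) + (1 - q ^ m)" if "m \<le> Suc n" for m
    using that by (simp add: right_diff_distrib flip: power_add power_Suc)
  have step: "q ^ m * (1 - q ^ (Suc n - m)) * t m + (1 - q * q ^ m) * t (Suc m) = (1 - d) * s m"
    if "m \<le> n" for m
  proof -
    define r where "r = n - m"
    have r: "n - m = r" "Suc n - m = Suc r" "Suc n - Suc m = r"
      using that by (auto simp: r_def)
    define X where "X = qpoch (b * (d * q) * q ^ m) q r"
    have X: "qpoch (b * d * q ^ m) q (Suc r) = (1 - b * d * q ^ m) * X"
            "qpoch (b * d * q ^ Suc m) q r = X"
      by (simp_all add: X_def qpoch_Suc_shift mult_ac)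
    have s: "s m = (-1) ^ m * q ^ (m choose 2) * (d * q) ^ m * qpoch b q m * X
        / (qpoch q q m * qpoch q q r)"
      by (simp add: s_def r X_def)
    have 1: "q ^ m * (1 - q ^ (Suc n - m)) * t m = (1 - b * d * q ^ m) * s m"
      unfolding t_def s r X
      using nz[of r] nz[of m] nz1[of r]
      by (simp add: qpoch_Suc[of q q r] power_mult_distrib divide_simps)
    have 2: "(1 - q * q ^ m) * t (Suc m) = - (d * (1 - b * q ^ m)) * s m"
      unfolding t_def s r X choose_two_Suc
      using nz[of r] nz[of m] nz1[of m]
      by (simp add: qpoch_Suc[of _ _ m] power_mult_distrib power_add divide_simps)
    show ?thesis unfolding 1 2 by (simp add: algebra_simps)
  qed
  have "(1 - q * q ^ n) * (\<Sum>m\<le>Suc n. t m)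
      = (\<Sum>m\<le>Suc n. q ^ m * (1 - q ^ (Suc n - m)) * t m) + (\<Sum>m\<le>Suc n. (1 - q ^ m) * t m)"
    by (simp only: sum_distrib_left flip: sum.distrib)
       (intro sum.cong refl, metis atMost_iff split distrib_right)
  also have "(\<Sum>m\<le>Suc n. (1 - q ^ m) * t m) = (\<Sum>m\<le>n. (1 - q * q ^ m) * t (Suc m))"
    by (subst sum.atMost_Suc_shift) simp
  also have "(\<Sum>m\<le>Suc n. q ^ m * (1 - q ^ (Suc n - m)) * t m)
      = (\<Sum>m\<le>n. q ^ m * (1 - q ^ (Suc n - m)) * t m)"
    by (simp only: sum.atMost_Suc) simp
  also have "\<dots> + (\<Sum>m\<le>n. (1 - q * q ^ m) * t (Suc m)) = (\<Sum>m\<le>n. (1 - d) * s m)"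
    using step by (simp flip: sum.distrib)
  also have "\<dots> = (1 - d) * (qpoch (d * q) q n / qpoch q q n)"
    unfolding Suc[of "d * q", symmetric] s_def sum_distrib_left ..
  finally have "(\<Sum>m\<le>Suc n. t m) = qpoch d q (Suc n) / qpoch q q (Suc n)"
    using nz1[of n] nz[of n]
    by (simp add: qpoch_Suc_shift[of d] qpoch_Suc[of q] field_simps del: sum.atMost_Suc)
  then show ?case unfolding t_def .
qed simp


section \<open>Infinite products and \<open>q\<close>-difference equations\<close>

lemma qpoch_base_nonzero:
  fixes q :: "'a :: real_normed_field"
  assumes "norm q < 1"
  shows "q ^ Suc k \<noteq> 1" "1 - q * q ^ k \<noteq> 0" "qpoch q q n \<noteq> 0"
proof -
  have *: "q ^ Suc k \<noteq> 1" for k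
  proof
    assume "q ^ Suc k = 1"
    then have "norm q ^ Suc k = 1" by (metis norm_one norm_power)
    moreover have "norm q * norm q ^ k \<le> norm q"
      using assms by (intro mult_left_le power_le_one) auto
    ultimately show False using assms by simp
  qed
  show "q ^ Suc k \<noteq> 1" "1 - q * q ^ k \<noteq> 0" using *[of k] by auto
  show "qpoch q q n \<noteq> 0" by (rule qpoch_nonzero) (use * in auto)
qed

lemma qpoch_inf_0: "qpoch_inf 0 q = 1"
  by (simp add: qpoch_inf_def)

lemma convergent_prod_qpoch:
  fixes a q :: "'a :: {real_normed_field, banach}"
  assumes "norm q < 1"
  shows "convergent_prod (\<lambda>j. 1 - a * q ^ j)"
proof -
  have "summable (\<lambda>j. norm (1 - a * q ^ j - 1))"
    using assms by (simp add: norm_mult norm_power summable_mult summable_geometric)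
  then show ?thesis
    by (intro abs_convergent_prod_imp_convergent_prod summable_imp_abs_convergent_prod)
qed

lemma qpoch_LIMSEQ:
  fixes a q :: "'a :: {real_normed_field, banach}"
  assumes "norm q < 1"
  shows "qpoch a q \<longlonglongrightarrow> qpoch_inf a q"
proof -
  have "(\<lambda>n. qpoch a q (Suc n)) \<longlonglongrightarrow> qpoch_inf a q"
    using convergent_prod_LIMSEQ[OF convergent_prod_qpoch[OF assms, of a]]
    by (simp add: qpoch_def qpoch_inf_def lessThan_Suc_atMost)
  then show ?thesis by (simp only: filterlim_sequentially_Suc)
qed

lemma qpoch_inf_split:
  fixes a q :: "'a :: {real_normed_field, banach}"
  assumes "norm q < 1"
  shows "qpoch_inf a q = qpoch a q n * qpoch_inf (a * q ^ n) q"
proof (rule LIMSEQ_unique)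
  show "(\<lambda>k. qpoch a q (n + k)) \<longlonglongrightarrow> qpoch_inf a q"
    using LIMSEQ_ignore_initial_segment[OF qpoch_LIMSEQ[OF assms, of a], of n] by (simp add: add.commute)
  show "(\<lambda>k. qpoch a q (n + k)) \<longlonglongrightarrow> qpoch a q n * qpoch_inf (a * q ^ n) q"
    unfolding qpoch_add by (intro tendsto_mult tendsto_const qpoch_LIMSEQ assms)
qed

lemma qpoch_inf_nonzero:
  fixes a q :: "'a :: {real_normed_field, banach}"
  assumes "norm q < 1" "\<And>k. a * q ^ k \<noteq> 1"
  shows "qpoch_inf a q \<noteq> 0"
  unfolding qpoch_inf_def
  using assms(2) by (intro prodinf_nonzero convergent_prod_qpoch assms) auto

lemma mult_power_neq_1:
  fixes z q :: "'a :: real_normed_field"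
  assumes "norm q < 1" "norm z < 1"
  shows "z * q ^ k \<noteq> 1"
proof
  assume "z * q ^ k = 1"
  then have "norm z * norm q ^ k = 1" by (metis norm_mult norm_one norm_power)
  moreover have "norm z * norm q ^ k \<le> norm z"
    using assms by (simp add: mult_left_le power_le_one)
  ultimately show False using assms by simp
qed

text \<open>The quotient of consecutive terms of a \<open>q\<close>-hypergeometric series is a rational function of
  \<open>q\<^sup>k\<close>, so its limit is found by setting \<open>q\<^sup>k = 0\<close>.\<close>

lemma ratio_limit_summable:
  fixes f :: "nat \<Rightarrow> 'a :: real_normed_field"
  assumes "\<And>k. f (Suc k) = r k * f k" "r \<longlonglongrightarrow> L" "norm L < 1"
  shows "summable (\<lambda>k. norm (f k))"
proof -
  obtain c where c: "norm L < c" "c < 1" using dense[OF assms(3)] by auto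
  have "(\<lambda>k. norm (r k)) \<longlonglongrightarrow> norm L" by (intro tendsto_norm assms)
  from order_tendstoD(2)[OF this c(1)] obtain N where N: "\<And>k. k \<ge> N \<Longrightarrow> norm (r k) < c"
    by (auto simp: eventually_sequentially)
  show ?thesis
  proof (rule summable_ratio_test[OF c(2)])
    fix k assume "N \<le> k"
    then show "norm (norm (f (Suc k))) \<le> c * norm (norm (f k))"
      using N[of k] by (simp add: assms(1) norm_mult mult_right_mono)
  qed
qed

lemma power_LIMSEQ_zero:
  fixes q :: "'a :: real_normed_field"
  assumes "norm q < 1"
  shows "(\<lambda>k. q ^ k) \<longlonglongrightarrow> 0" "(\<lambda>k. a * q ^ k) \<longlonglongrightarrow> 0"
  using LIMSEQ_power_zero[OF assms] tendsto_mult_right_zero by auto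

text \<open>A first-order \<open>q\<close>-difference equation determines its solution up to the limit at \<open>0\<close>: iterating
  it \<open>n\<close> times produces the partial products on both sides.  The \<open>q\<close>-binomial theorem, Euler's
  series and the partial fractions of \<open>1/(-x;q)\<^sub>\<infinity>\<close> are all obtained from this.\<close>

lemma q_difference_solution:
  fixes F :: "'a \<Rightarrow> 'a :: {real_normed_field, banach}"
  assumes "norm q < 1" "(\<lambda>n. F (z * q ^ n)) \<longlonglongrightarrow> L"
    and "\<And>n. (1 - b * (z * q ^ n)) * F (z * q ^ n) = (1 - a * (z * q ^ n)) * F (z * q ^ Suc n)"
  shows "F z * qpoch_inf (b * z) q = L * qpoch_inf (a * z) q"
proof (rule LIMSEQ_unique)
  have "F z * qpoch (b * z) q n = F (z * q ^ n) * qpoch (a * z) q n" for n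
  proof (induction n)
    case (Suc n)
    have "F z * qpoch (b * z) q (Suc n) = F z * qpoch (b * z) q n * (1 - b * (z * q ^ n))"
      by (simp add: qpoch_Suc mult_ac)
    also have "\<dots> = (1 - b * (z * q ^ n)) * F (z * q ^ n) * qpoch (a * z) q n"
      unfolding Suc by (simp add: mult_ac)
    also have "\<dots> = F (z * q ^ Suc n) * qpoch (a * z) q (Suc n)"
      unfolding assms(3) by (simp add: qpoch_Suc mult_ac)
    finally show ?case .
  qed simp
  moreover have "(\<lambda>n. F (z * q ^ n) * qpoch (a * z) q n) \<longlonglongrightarrow> L * qpoch_inf (a * z) q"
    by (intro tendsto_mult assms qpoch_LIMSEQ)
  ultimately show "(\<lambda>n. F z * qpoch (b * z) q n) \<longlonglongrightarrow> L * qpoch_inf (a * z) q"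
    by simp
  show "(\<lambda>n. F z * qpoch (b * z) q n) \<longlonglongrightarrow> F z * qpoch_inf (b * z) q"
    by (intro tendsto_mult tendsto_const assms qpoch_LIMSEQ)
qed

text \<open>The recurrence for the coefficients says that the power series \<open>F\<close> satisfies
  \<open>(1 - b z) F(z) = (1 - a z) F(q z)\<close>.  The case \<open>b = 1\<close> is the \<open>q\<close>-binomial theorem, and \<open>b = 0\<close>
  is Euler's series, which converges everywhere.\<close>

lemma q_binomial_recurrence:
  fixes c :: "nat \<Rightarrow> 'a :: {real_normed_field, banach}"
  assumes q: "norm q < 1" and z: "norm (b * z) < 1"
    and c0: "c 0 = 1"
    and rec: "\<And>k. c (Suc k) * (1 - q ^ Suc k) = c k * (b - a * q ^ k)"
  shows "summable (\<lambda>k. norm (c k * z ^ k))"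
    and "(\<Sum>k. c k * z ^ k) * qpoch_inf (b * z) q = qpoch_inf (a * z) q"
proof -
  note nz = qpoch_base_nonzero[OF q]
  have S: "summable (\<lambda>k. norm (c k * y ^ k))" if "norm (b * y) < 1" for y
  proof (rule ratio_limit_summable)
    fix k
    show "c (Suc k) * y ^ Suc k = ((b - a * q ^ k) / (1 - q * q ^ k) * y) * (c k * y ^ k)"
    proof -
      have "c (Suc k) = c k * (b - a * q ^ k) / (1 - q * q ^ k)"
        using rec[of k] nz(2)[of k] by (simp add: eq_divide_eq)
      then show ?thesis by simp
    qed
    have "(\<lambda>k. (b - a * q ^ k) / (1 - q * q ^ k) * y) \<longlonglongrightarrow> (b - 0) / (1 - 0) * y"
      by (intro tendsto_intros power_LIMSEQ_zero q) simp
    then show "(\<lambda>k. (b - a * q ^ k) / (1 - q * q ^ k) * y) \<longlonglongrightarrow> b * y" by simp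
  qed (use that in auto)
  show "summable (\<lambda>k. norm (c k * z ^ k))" by (rule S[OF z])
  define F where "F = (\<lambda>y. \<Sum>k. c k * y ^ k)"
  have small: "norm (b * (z * q ^ n)) < 1" for n
  proof -
    have "norm (b * (z * q ^ n)) \<le> norm (b * z)"
      using q by (simp add: norm_mult norm_power mult_left_le power_le_one mult_left_mono)
    then show ?thesis using z by simp
  qed
  have F0: "F 0 = 1" by (simp add: F_def c0)
  have "F z * qpoch_inf (b * z) q = F 0 * qpoch_inf (a * z) q"
  proof (rule q_difference_solution[OF q])
    show "(\<lambda>n. F (z * q ^ n)) \<longlonglongrightarrow> F 0"
    proof (cases "z = 0")
      case False
      have "isCont F 0"
        unfolding F_def
        by (rule isCont_powser[OF summable_norm_cancel[OF S[OF z]]]) (use False in simp)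
      then show ?thesis
        by (rule isCont_tendsto_compose) (rule power_LIMSEQ_zero[OF q])
    qed simp
  next
    fix n
    define y where "y = z * q ^ n"
    have y: "norm (b * y) < 1" and yq: "norm (b * (y * q)) < 1"
      using small[of n] small[of "Suc n"] by (simp_all add: y_def mult_ac)
    note Sy = summable_norm_cancel[OF S[OF y]] and Syq = summable_norm_cancel[OF S[OF yq]]
    have "F y - F (y * q) = (\<Sum>k. c k * (1 - q ^ k) * y ^ k)"
      unfolding F_def
      by (subst suminf_diff[OF Sy Syq]) (simp add: algebra_simps power_mult_distrib)
    also have "\<dots> = (\<Sum>k. c (Suc k) * (1 - q ^ Suc k) * y ^ Suc k)"
    proof (subst suminf_split_head)
      have "summable (\<lambda>k. c k * y ^ k - c k * (y * q) ^ k)" by (intro summable_diff Sy Syq)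
      then show "summable (\<lambda>k. c k * (1 - q ^ k) * y ^ k)"
        by (simp add: algebra_simps power_mult_distrib)
    qed simp
    also have "\<dots> = (\<Sum>k. b * y * (c k * y ^ k) - a * y * (c k * (y * q) ^ k))"
      unfolding rec by (simp add: algebra_simps power_mult_distrib)
    also have "\<dots> = b * y * F y - a * y * F (y * q)"
      unfolding F_def
      by (simp add: suminf_diff[symmetric] suminf_mult summable_mult Sy Syq)
    finally have "(1 - b * y) * F y = (1 - a * y) * F (y * q)" by (simp add: algebra_simps)
    then show "(1 - b * (z * q ^ n)) * F (z * q ^ n) = (1 - a * (z * q ^ n)) * F (z * q ^ Suc n)"
      by (simp add: y_def mult_ac)
  qed
  then show "(\<Sum>k. c k * z ^ k) * qpoch_inf (b * z) q = qpoch_inf (a * z) q"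
    by (simp add: F0) (simp add: F_def)
qed

lemma q_binomial:
  fixes a q z :: "'a :: {real_normed_field, banach}"
  assumes q: "norm q < 1" and z: "norm z < 1"
  shows "(\<lambda>k. qpoch a q k / qpoch q q k * z ^ k) sums (qpoch_inf (a * z) q / qpoch_inf z q)"
proof -
  define c where "c = (\<lambda>k. qpoch a q k / qpoch q q k)"
  have rec: "c (Suc k) * (1 - q ^ Suc k) = c k * (1 - a * q ^ k)" for k
  proof -
    define D where "D = 1 - q ^ Suc k"
    have D: "D \<noteq> 0" using qpoch_base_nonzero(1)[OF q, of k] by (auto simp: D_def)
    have "qpoch q q (Suc k) = qpoch q q k * D" by (simp add: D_def qpoch_Suc)
    then show ?thesis
      unfolding c_def D_def[symmetric] qpoch_Suc[of a] using D by simp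
  qed
  have 1: "norm (1 * z) < 1" using z by simp
  have c0: "c 0 = 1" by (simp add: c_def)
  note B = q_binomial_recurrence[where c = c and b = 1 and z = z and q = q and a = a, OF q 1 c0 rec]
  have "qpoch_inf z q \<noteq> 0"
    by (intro qpoch_inf_nonzero q mult_power_neq_1 z)
  then have E: "(\<Sum>k. c k * z ^ k) = qpoch_inf (a * z) q / qpoch_inf z q"
    using B(2) by (simp add: eq_divide_eq)
  have "(\<lambda>k. c k * z ^ k) sums (\<Sum>k. c k * z ^ k)"
    by (rule summable_sums[OF summable_norm_cancel[OF B(1)]])
  then show ?thesis unfolding E unfolding c_def .
qed

lemma euler_qpoch_inf:
  fixes q z :: "'a :: {real_normed_field, banach}"
  assumes q: "norm q < 1"
  shows "summable (\<lambda>k. norm ((-1) ^ k * q ^ (k choose 2) / qpoch q q k * z ^ k))"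
    and "(\<Sum>k. (-1) ^ k * q ^ (k choose 2) / qpoch q q k * z ^ k) = qpoch_inf z q"
proof -
  define c where "c = (\<lambda>k. (-1) ^ k * q ^ (k choose 2) / qpoch q q k)"
  have rec: "c (Suc k) * (1 - q ^ Suc k) = c k * (0 - 1 * q ^ k)" for k
  proof -
    define D where "D = 1 - q ^ Suc k"
    have D: "D \<noteq> 0" using qpoch_base_nonzero(1)[OF q, of k] by (auto simp: D_def)
    have "qpoch q q (Suc k) = qpoch q q k * D" by (simp add: D_def qpoch_Suc)
    then show ?thesis
      unfolding c_def choose_two_Suc D_def[symmetric] power_add using D by simp
  qed
  have 1: "norm (0 * z) < 1" by simp
  have c0: "c 0 = 1" by (simp add: c_def)
  note B = q_binomial_recurrence[where c = c and b = 0 and z = z and q = q and a = 1, OF q 1 c0 rec]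
  show "summable (\<lambda>k. norm ((-1) ^ k * q ^ (k choose 2) / qpoch q q k * z ^ k))"
    using B(1) unfolding c_def .
  show "(\<Sum>k. (-1) ^ k * q ^ (k choose 2) / qpoch q q k * z ^ k) = qpoch_inf z q"
    using B(2) unfolding c_def mult_zero_left mult_1 qpoch_inf_0 mult_1_right .
qed

section \<open>Jackson's transformation\<close>

text \<open>Summation along the antidiagonals \<open>r + m = k\<close> equals summation by rows; the domination by a
  product of two summable sequences provides the absolute convergence on \<open>\<nat> \<times> \<nat>\<close>.\<close>

lemma suminf_triangle:
  fixes T :: "nat \<Rightarrow> nat \<Rightarrow> 'a :: banach"
  assumes bound: "\<And>r m. norm (T r m) \<le> u r * v m"
    and u: "summable u" "\<And>r. u r \<ge> 0" and v: "summable v" "\<And>m. v m \<ge> 0"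
  shows "(\<Sum>k. \<Sum>m\<le>k. T (k - m) m) = (\<Sum>m. \<Sum>r. T r m)"
proof -
  have inner: "summable (\<lambda>r. norm (T r m))" for m
    by (rule summable_comparison_test'[of "\<lambda>r. u r * v m" 0])
       (use bound u in \<open>auto intro: summable_mult2\<close>)
  define f where "f = (\<lambda>(m, r). T r m)"
  have "(\<lambda>(m, r). u r * v m) summable_on UNIV \<times> UNIV"
  proof (rule summable_on_SigmaI)
    fix m :: nat
    have "((\<lambda>r. u r * v m) has_sum (\<Sum>r. u r) * v m) UNIV"
      by (rule norm_summable_imp_has_sum)
         (use u v in \<open>auto simp: abs_mult intro!: summable_mult2 summable_sums sums_mult2\<close>)
    then show "((\<lambda>r. case (m, r) of (m, r) \<Rightarrow> u r * v m) has_sum (\<Sum>r. u r) * v m) UNIV"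
      by simp
  next
    show "(\<lambda>m. (\<Sum>r. u r) * v m) summable_on UNIV"
      by (rule norm_summable_imp_summable_on)
         (use u v in \<open>auto simp: abs_mult suminf_nonneg intro!: summable_mult\<close>)
  qed (use u v in auto)
  then have "(\<lambda>x. norm (f x)) summable_on UNIV \<times> UNIV"
    by (rule Infinite_Sum.abs_summable_on_comparison_test') (use bound in \<open>auto simp: f_def\<close>)
  then have "f summable_on UNIV \<times> UNIV"
    by (rule abs_summable_summable)
  then obtain S where S: "(f has_sum S) (UNIV \<times> UNIV)"
    unfolding summable_on_def by blast
  have "((\<lambda>m. \<Sum>r. T r m) has_sum S) UNIV"
  proof (rule has_sum_SigmaD[OF S])
    fix m :: nat
    have "((\<lambda>r. T r m) has_sum (\<Sum>r. T r m)) UNIV"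
      by (rule norm_summable_imp_has_sum[OF inner summable_sums[OF summable_norm_cancel[OF inner]]])
    then show "((\<lambda>r. f (m, r)) has_sum (\<Sum>r. T r m)) UNIV"
      by (simp add: f_def)
  qed
  then have 1: "(\<lambda>m. \<Sum>r. T r m) sums S" by (rule has_sum_imp_sums)
  have "((\<lambda>(k, m). T (k - m) m) has_sum S) (SIGMA k:UNIV. {..k}) \<longleftrightarrow> (f has_sum S) (UNIV \<times> UNIV)"
    by (rule has_sum_reindex_bij_witness[where i = "\<lambda>(m, r). (r + m, m)" and j = "\<lambda>(k, m). (m, k - m)"])
       (auto simp: f_def)
  with S have S': "((\<lambda>(k, m). T (k - m) m) has_sum S) (SIGMA k:UNIV. {..k})" by simp
  have "((\<lambda>k. \<Sum>m\<le>k. T (k - m) m) has_sum S) UNIV"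
    by (rule has_sum_SigmaD[OF S']) (simp add: has_sum_finite)
  then have 2: "(\<lambda>k. \<Sum>m\<le>k. T (k - m) m) sums S" by (rule has_sum_imp_sums)
  show ?thesis using 1 2 by (simp add: sums_iff)
qed

lemma qpoch_bounded:
  fixes a q :: "'a :: {real_normed_field, banach}"
  assumes "norm q < 1"
  obtains K where "K > 0" "\<And>n. norm (qpoch a q n) \<le> K"
proof -
  have "Bseq (qpoch a q)"
    using qpoch_LIMSEQ[OF assms] by (intro convergent_imp_Bseq) (auto simp: convergent_def)
  then show ?thesis using that by (elim BseqE) auto
qed

lemma inverse_qpoch_bounded:
  fixes q :: "'a :: {real_normed_field, banach}"
  assumes "norm q < 1"
  obtains K where "K > 0" "\<And>n. norm (inverse (qpoch q q n)) \<le> K"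
proof -
  have "qpoch_inf q q \<noteq> 0"
    using qpoch_base_nonzero(2)[OF assms] by (intro qpoch_inf_nonzero assms) auto
  then have "(\<lambda>n. inverse (qpoch q q n)) \<longlonglongrightarrow> inverse (qpoch_inf q q)"
    by (intro tendsto_inverse qpoch_LIMSEQ assms)
  then have "Bseq (\<lambda>n. inverse (qpoch q q n))"
    by (intro convergent_imp_Bseq) (auto simp: convergent_def)
  then show ?thesis using that by (elim BseqE) auto
qed

text \<open>Jackson's transformation of \<open>\<^sub>2\<phi>\<^sub>1(a, b; bd; q, z)\<close> into
  \<open>\<^sub>2\<phi>\<^sub>2(a, d; bd, az; q, bz)\<close>.  The quotient \<open>(b;q)\<^sub>k / (bd;q)\<^sub>k\<close> is expanded by
  \<open>q\<close>-Chu-Vandermonde into a sum over \<open>m \<le> k\<close>; after interchanging the summations the inner sum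
  over \<open>r = k - m\<close> is \<open>(a;q)\<^sub>m\<close> times a \<open>q\<close>-binomial series with parameter \<open>a q\<^sup>m\<close>.\<close>

lemma jackson_transformation:
  fixes a b d q z :: "'a :: {real_normed_field, banach}"
  assumes q: "norm q < 1" and z: "norm z < 1"
    and c: "\<And>k. b * d * q ^ k \<noteq> 1" and az: "\<And>k. a * z * q ^ k \<noteq> 1"
  shows "(\<Sum>k. qpoch a q k * qpoch b q k / (qpoch q q k * qpoch (b * d) q k) * z ^ k) * qpoch_inf z q
    = qpoch_inf (a * z) q * (\<Sum>m. qpoch a q m * qpoch d q m
        / (qpoch q q m * qpoch (b * d) q m * qpoch (a * z) q m)
        * ((-1) ^ m * q ^ (m choose 2)) * (b * z) ^ m)"
proof -
  note nz = qpoch_base_nonzero[OF q]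
  have cnz: "qpoch (b * d) q k \<noteq> 0" for k by (rule qpoch_nonzero[OF c])
  have aznz: "qpoch (a * z) q k \<noteq> 0" for k by (rule qpoch_nonzero[OF az])
  have zinf: "qpoch_inf z q \<noteq> 0" by (intro qpoch_inf_nonzero q mult_power_neq_1 z)
  define w where "w = (\<lambda>m. (-1) ^ m * q ^ (m choose 2) * (b * z) ^ m * qpoch d q m
      / (qpoch (b * d) q m * qpoch q q m))"
  define T where "T = (\<lambda>r m. qpoch a q (r + m) / qpoch q q r * z ^ r * w m)"
  have row: "(\<Sum>m\<le>k. T (k - m) m)
      = qpoch a q k * qpoch b q k / (qpoch q q k * qpoch (b * d) q k) * z ^ k" for k
  proof -
    have "(\<Sum>m\<le>k. T (k - m) m) = (\<Sum>m\<le>k. qpoch a q k * z ^ k / qpoch (b * d) q k *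
        ((-1) ^ m * q ^ (m choose 2) * b ^ m * qpoch d q m * qpoch (d * b * q ^ m) q (k - m)
            / (qpoch q q m * qpoch q q (k - m))))"
    proof (rule sum.cong)
      fix m assume "m \<in> {..k}"
      then have "m \<le> k" by simp
      define r where "r = k - m"
      have k: "k = m + r" using \<open>m \<le> k\<close> by (simp add: r_def)
      have bd: "d * b = b * d" by (rule mult.commute)
      have "qpoch (b * d * q ^ m) q r \<noteq> 0"
        using cnz[of "m + r"] unfolding qpoch_add by simp
      then show "T (k - m) m = qpoch a q k * z ^ k / qpoch (b * d) q k *
        ((-1) ^ m * q ^ (m choose 2) * b ^ m * qpoch d q m * qpoch (d * b * q ^ m) q (k - m)
            / (qpoch q q m * qpoch q q (k - m)))"
        using cnz[of m] nz(3)[of m] nz(3)[of r]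
        unfolding bd k T_def w_def qpoch_add[of "b * d"]
        by (simp add: power_mult_distrib power_add add.commute[of r m] mult_ac)
    qed simp
    also have "\<dots> = qpoch a q k * z ^ k / qpoch (b * d) q k * (qpoch b q k / qpoch q q k)"
      by (subst sum_distrib_left[symmetric], subst q_chu_vandermonde[OF nz(1)]) (rule refl)
    finally show ?thesis by (simp add: mult_ac)
  qed
  have col: "(\<Sum>r. T r m) = qpoch_inf (a * z) q / qpoch_inf z q
      * (qpoch a q m * qpoch d q m / (qpoch q q m * qpoch (b * d) q m * qpoch (a * z) q m)
        * ((-1) ^ m * q ^ (m choose 2)) * (b * z) ^ m)" for m
  proof -
    have "(\<lambda>r. qpoch a q m * w m * (qpoch (a * q ^ m) q r / qpoch q q r * z ^ r))
        sums (qpoch a q m * w m * (qpoch_inf (a * q ^ m * z) q / qpoch_inf z q))"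
      by (intro sums_mult q_binomial q z)
    moreover have "qpoch a q m * w m * (qpoch (a * q ^ m) q r / qpoch q q r * z ^ r) = T r m" for r
      unfolding T_def add.commute[of r m] unfolding qpoch_add by simp
    ultimately have "(\<Sum>r. T r m) = qpoch a q m * w m * (qpoch_inf (a * q ^ m * z) q / qpoch_inf z q)"
      by (simp add: sums_iff)
    also have "qpoch_inf (a * q ^ m * z) q = qpoch_inf (a * z) q / qpoch (a * z) q m"
      using qpoch_inf_split[OF q, of "a * z" m] aznz[of m] by (simp add: mult_ac)
    finally show ?thesis by (simp add: w_def mult_ac)
  qed
  obtain A where A: "A > 0" "\<And>n. norm (qpoch a q n) \<le> A" using qpoch_bounded[OF q] by blast
  obtain B where B: "B > 0" "\<And>n. norm (inverse (qpoch q q n)) \<le> B"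
    using inverse_qpoch_bounded[OF q] by blast
  have "summable (\<lambda>m. norm (w m))"
  proof (rule ratio_limit_summable)
    fix m
    have "1 - b * d * q ^ m \<noteq> 0" using c[of m] by simp
    then show "w (Suc m) = (- (q ^ m * (b * z) * (1 - d * q ^ m))
        / ((1 - b * d * q ^ m) * (1 - q * q ^ m))) * w m"
      using nz(2)[of m] nz(3)[of m] cnz[of m]
      by (simp add: w_def qpoch_Suc choose_two_Suc power_add mult_ac)
    have "(\<lambda>m. - (q ^ m * (b * z) * (1 - d * q ^ m)) / ((1 - b * d * q ^ m) * (1 - q * q ^ m)))
        \<longlonglongrightarrow> - (0 * (b * z) * (1 - 0)) / ((1 - 0) * (1 - 0))"
      by (intro tendsto_intros power_LIMSEQ_zero q) simp
    then show "(\<lambda>m. - (q ^ m * (b * z) * (1 - d * q ^ m)) / ((1 - b * d * q ^ m) * (1 - q * q ^ m)))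
        \<longlonglongrightarrow> 0" by simp
  qed simp
  then have "(\<Sum>k. \<Sum>m\<le>k. T (k - m) m) = (\<Sum>m. \<Sum>r. T r m)"
  proof (intro suminf_triangle[where u = "\<lambda>r. A * B * norm z ^ r" and v = "\<lambda>m. norm (w m)"])
    fix r m
    have "norm (T r m) = norm (qpoch a q (r + m)) * norm (inverse (qpoch q q r)) * (norm z ^ r * norm (w m))"
      by (simp add: T_def norm_mult norm_divide norm_power norm_inverse divide_inverse)
    also have "\<dots> \<le> A * B * (norm z ^ r * norm (w m))"
      using A B by (intro mult_right_mono mult_mono) (auto intro: less_imp_le)
    finally show "norm (T r m) \<le> A * B * norm z ^ r * norm (w m)" by simp
  qed (use A B z in \<open>auto intro!: summable_mult summable_geometric\<close>)
  also have "\<dots> = qpoch_inf (a * z) q / qpoch_inf z q *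
     (\<Sum>m. qpoch a q m * qpoch d q m / (qpoch q q m * qpoch (b * d) q m * qpoch (a * z) q m)
        * ((-1) ^ m * q ^ (m choose 2)) * (b * z) ^ m)"
  proof -
    have "summable (\<lambda>m. qpoch a q m * qpoch d q m / (qpoch q q m * qpoch (b * d) q m * qpoch (a * z) q m)
        * ((-1) ^ m * q ^ (m choose 2)) * (b * z) ^ m)"
      (is "summable ?s")
    proof (rule summable_norm_cancel, rule ratio_limit_summable)
      fix m
      have "1 - b * d * q ^ m \<noteq> 0" "1 - a * z * q ^ m \<noteq> 0" using c[of m] az[of m] by simp_all
      then show "?s (Suc m) = (- (q ^ m * (b * z) * (1 - d * q ^ m) * (1 - a * q ^ m))
          / ((1 - b * d * q ^ m) * (1 - q * q ^ m) * (1 - a * z * q ^ m))) * ?s m"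
        using nz(2)[of m] nz(3)[of m] cnz[of m] aznz[of m]
        by (simp add: qpoch_Suc choose_two_Suc power_add mult_ac)
      have "(\<lambda>m. - (q ^ m * (b * z) * (1 - d * q ^ m) * (1 - a * q ^ m))
          / ((1 - b * d * q ^ m) * (1 - q * q ^ m) * (1 - a * z * q ^ m)))
          \<longlonglongrightarrow> - (0 * (b * z) * (1 - 0) * (1 - 0)) / ((1 - 0) * (1 - 0) * (1 - 0))"
        by (intro tendsto_intros power_LIMSEQ_zero q) simp
      then show "(\<lambda>m. - (q ^ m * (b * z) * (1 - d * q ^ m) * (1 - a * q ^ m))
          / ((1 - b * d * q ^ m) * (1 - q * q ^ m) * (1 - a * z * q ^ m))) \<longlonglongrightarrow> 0" by simp
    qed simp
    then show ?thesis unfolding col by (rule suminf_mult)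
  qed
  finally show ?thesis unfolding row using zinf by simp
qed

section \<open>Partial fractions of the reciprocal infinite product\<close>

lemma isCont_qpoch_inf:
  fixes q z :: "'a :: {real_normed_field, banach}"
  assumes "norm q < 1"
  shows "isCont (\<lambda>z. qpoch_inf z q) z"
  using isCont_powser_converges_everywhere[OF summable_norm_cancel[OF euler_qpoch_inf(1)[OF assms]]]
  unfolding euler_qpoch_inf(2)[OF assms] by blast

context
  fixes q :: real
  assumes q: "0 < q" "q < 1"
begin

lemma norm_q_less: "norm q < 1" using q by simp

lemma qpoch_inf_neg_mono:
  assumes "0 \<le> x" "x \<le> y"
  shows "qpoch_inf (- x) q \<le> qpoch_inf (- y) q"
proof (rule LIMSEQ_le[OF qpoch_LIMSEQ qpoch_LIMSEQ])
  have "qpoch (- x) q n \<le> qpoch (- y) q n" for n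
    unfolding qpoch_def using assms q
    by (intro prod_mono) (auto intro!: add_nonneg_nonneg mult_right_mono)
  then show "\<exists>N. \<forall>n\<ge>N. qpoch (- x) q n \<le> qpoch (- y) q n" by blast
qed (use q in auto)

lemma qpoch_inf_neg_shift: "qpoch_inf (- x) q = (1 + x) * qpoch_inf (- (q * x)) q"
  using qpoch_inf_split[OF norm_q_less, of "- x" 1] by (simp add: qpoch_Suc mult.commute)

lemma qpoch_inf_neg_ge:
  assumes "0 \<le> x"
  shows "1 + x \<le> qpoch_inf (- x) q"
proof -
  have "1 \<le> qpoch_inf (- (q * x)) q"
    using qpoch_inf_neg_mono[of 0 "q * x"] q assms by (simp add: qpoch_inf_0)
  then show ?thesis
    unfolding qpoch_inf_neg_shift[of x] using assms by (simp add: mult_le_cancel_left1)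
qed

lemma qpoch_inf_neg_pos: "0 \<le> x \<Longrightarrow> 0 < qpoch_inf (- x) q"
  using qpoch_inf_neg_ge[of x] by linarith

text \<open>Let \<open>F(x)\<close> be the series and \<open>e\<^sub>k\<close> the coefficients of Euler's series.  From
  \<open>(1 + x) q\<^sup>k / (1 + x q\<^sup>k) = 1 - (1 - q\<^sup>k) / (1 + x q\<^sup>k)\<close> and the recurrence of the \<open>e\<^sub>k\<close> one gets
  \<open>(1 + x) F(x) = \<Sum>e\<^sub>k + F(q x)\<close>, and \<open>\<Sum>e\<^sub>k = (1;q)\<^sub>\<infinity> = 0\<close>.  Thus \<open>F\<close> satisfies the same
  \<open>q\<close>-difference equation as \<open>1/(-x;q)\<^sub>\<infinity>\<close>, and the two are compared at \<open>0\<close>, where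
  \<open>F(0) = \<Sum>e\<^sub>k q\<^sup>k = (q;q)\<^sub>\<infinity>\<close>.\<close>

lemma partial_fractions_inverse_qpoch_inf:
  assumes x: "0 \<le> x"
  shows "summable (\<lambda>k. norm ((-1) ^ k * q ^ (k choose 2) / qpoch q q k * q ^ k / (1 + x * q ^ k)))"
    and "(\<Sum>k. (-1) ^ k * q ^ (k choose 2) / qpoch q q k * q ^ k / (1 + x * q ^ k)) * qpoch_inf (- x) q
       = qpoch_inf q q"
proof -
  define e where "e = (\<lambda>k. (-1) ^ k * q ^ (k choose 2) / qpoch q q k)"
  define F where "F = (\<lambda>y. \<Sum>k. e k * q ^ k / (1 + y * q ^ k))"
  have Se: "summable (\<lambda>k. norm (e k * z ^ k))" and Ee: "(\<Sum>k. e k * z ^ k) = qpoch_inf z q" for z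
    using euler_qpoch_inf[OF norm_q_less] unfolding e_def by auto
  have rec: "e (Suc k) * (1 - q ^ Suc k) = - (e k * q ^ k)" for k
  proof -
    define D where "D = 1 - q ^ Suc k"
    have D: "D \<noteq> 0" using qpoch_base_nonzero(1)[OF norm_q_less, of k] by (auto simp: D_def)
    have "qpoch q q (Suc k) = qpoch q q k * D" by (simp add: D_def qpoch_Suc)
    then show ?thesis
      unfolding e_def choose_two_Suc D_def[symmetric] power_add using D by simp
  qed
  have term_bound: "norm (e k * q ^ k / (1 + y * q ^ k)) \<le> norm (e k * q ^ k)" if "y \<ge> 0" for y k
  proof -
    have "1 \<le> 1 + y * q ^ k" using that q by simp
    then have "\<bar>e k * q ^ k\<bar> / (1 + y * q ^ k) \<le> \<bar>e k * q ^ k\<bar> / 1"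
      by (intro divide_left_mono) auto
    then show ?thesis using \<open>1 \<le> 1 + y * q ^ k\<close> by (simp add: abs_divide)
  qed
  have SFn: "summable (\<lambda>k. norm (e k * q ^ k / (1 + y * q ^ k)))" if "y \<ge> 0" for y
    by (rule summable_comparison_test'[OF Se[of q], of 0]) (use term_bound[OF that] in auto)
  then show "summable (\<lambda>k. norm ((-1) ^ k * q ^ (k choose 2) / qpoch q q k * q ^ k / (1 + x * q ^ k)))"
    using x unfolding e_def by blast
  have SF: "summable (\<lambda>k. e k * q ^ k / (1 + y * q ^ k))" if "y \<ge> 0" for y
    by (rule summable_norm_cancel[OF SFn[OF that]])
  have fe: "(1 + y) * F y = F (y * q)" if y: "y \<ge> 0" for y
  proof -
    have y1: "1 + y * q ^ k > 0" for k
      using y q by (simp add: add_pos_nonneg)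
    have S1: "summable e" using summable_norm_cancel[OF Se[of 1]] by simp
    have E1: "suminf e = 0"
      using Ee[of 1] qpoch_inf_split[OF norm_q_less, of 1 1] by (simp add: qpoch_Suc)
    have t: "(1 + y) * (e k * q ^ k / (1 + y * q ^ k)) = e k - e k * (1 - q ^ k) / (1 + y * q ^ k)" for k
      using y1[of k] by (simp add: field_simps)
    have "(1 + y) * F y = (\<Sum>k. e k - e k * (1 - q ^ k) / (1 + y * q ^ k))"
      unfolding F_def t[symmetric] by (rule suminf_mult[OF SF[OF y], symmetric])
    also have "\<dots> = suminf e - (\<Sum>k. e k * (1 - q ^ k) / (1 + y * q ^ k))"
    proof (rule suminf_diff[symmetric, OF S1])
      have "summable (\<lambda>k. e k - (1 + y) * (e k * q ^ k / (1 + y * q ^ k)))"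
        by (intro summable_diff S1 summable_mult SF y)
      then show "summable (\<lambda>k. e k * (1 - q ^ k) / (1 + y * q ^ k))" unfolding t by simp
    qed
    also have "(\<Sum>k. e k * (1 - q ^ k) / (1 + y * q ^ k))
        = (\<Sum>k. e (Suc k) * (1 - q ^ Suc k) / (1 + y * q ^ Suc k))"
    proof (subst suminf_split_head)
      have "summable (\<lambda>k. e k - (1 + y) * (e k * q ^ k / (1 + y * q ^ k)))"
        by (intro summable_diff S1 summable_mult SF y)
      then show "summable (\<lambda>k. e k * (1 - q ^ k) / (1 + y * q ^ k))" unfolding t by simp
    qed simp
    also have "\<dots> = (\<Sum>k. - (e k * q ^ k / (1 + (y * q) * q ^ k)))"
      unfolding rec by (simp add: mult_ac)
    also have "\<dots> = - F (y * q)"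
      unfolding F_def by (rule suminf_minus[OF SF]) (use y q in auto)
    finally show ?thesis by (simp add: E1)
  qed
  have "F x * qpoch_inf (- 1 * x) q = qpoch_inf q q * qpoch_inf (0 * x) q"
  proof (rule q_difference_solution[OF norm_q_less])
    show "(1 - - 1 * (x * q ^ n)) * F (x * q ^ n) = (1 - 0 * (x * q ^ n)) * F (x * q ^ Suc n)" for n
      using fe[of "x * q ^ n"] x q by (simp add: mult_ac)
    \<comment> \<open>the limit at \<open>0\<close> is taken inside the sum by dominated convergence\<close>
    have "((\<lambda>n. \<Sum>k. e k * q ^ k / (1 + x * q ^ n * q ^ k)) \<longlongrightarrow> (\<Sum>k. e k * q ^ k)) sequentially"
    proof (rule tannerys_theorem[THEN conjunct2, THEN conjunct2])
      fix k
      have "(\<lambda>n. e k * q ^ k / (1 + x * q ^ n * q ^ k)) \<longlonglongrightarrow> e k * q ^ k / (1 + 0 * q ^ k)"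
        by (intro tendsto_intros power_LIMSEQ_zero norm_q_less) simp
      then show "(\<lambda>n. e k * q ^ k / (1 + x * q ^ n * q ^ k)) \<longlonglongrightarrow> e k * q ^ k" by simp
    next
      show "\<forall>\<^sub>F (k, n) in sequentially \<times>\<^sub>F sequentially.
          norm (e k * q ^ k / (1 + x * q ^ n * q ^ k)) \<le> norm (e k * q ^ k)"
        by (rule always_eventually) (use term_bound x q in auto)
    qed (use Se in auto)
    then show "(\<lambda>n. F (x * q ^ n)) \<longlonglongrightarrow> qpoch_inf q q"
      unfolding F_def Ee .
  qed
  then show "(\<Sum>k. (-1) ^ k * q ^ (k choose 2) / qpoch q q k * q ^ k / (1 + x * q ^ k)) * qpoch_inf (- x) q
       = qpoch_inf q q" by (simp add: qpoch_inf_0 F_def e_def)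
qed

end

section \<open>Integrals over the positive half line\<close>

lemma has_bochner_integral_suminf:
  fixes f :: "nat \<Rightarrow> 'a \<Rightarrow> 'b :: {banach, second_countable_topology}"
  assumes f: "\<And>i. has_bochner_integral M (f i) (I i)"
    and s: "\<And>x. x \<in> space M \<Longrightarrow> summable (\<lambda>i. norm (f i x))"
    and J: "\<And>i. (\<integral>x. norm (f i x) \<partial>M) \<le> J i" "summable J"
  shows "has_bochner_integral M (\<lambda>x. \<Sum>i. f i x) (\<Sum>i. I i)" and "summable I"
proof -
  have int: "integrable M (f i)" and I: "integral\<^sup>L M (f i) = I i" for i
    using f[of i] by (auto simp: has_bochner_integral_iff)
  have AE: "AE x in M. summable (\<lambda>i. norm (f i x))" using s by (rule AE_I2)
  have S: "summable (\<lambda>i. (\<integral>x. norm (f i x) \<partial>M))"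
    by (rule summable_comparison_test'[OF J(2), of 0]) (use J in simp)
  show "summable I" using summable_integral[OF int AE S] I by simp
  show "has_bochner_integral M (\<lambda>x. \<Sum>i. f i x) (\<Sum>i. I i)"
    unfolding has_bochner_integral_iff
    using integrable_suminf[OF int AE S] integral_suminf[OF int AE S] I by simp
qed

lemma has_bochner_integral_half_line_scale:
  fixes f :: "real \<Rightarrow> real"
  assumes "has_bochner_integral (lebesgue_on {0<..}) f I" "c > 0"
  shows "has_bochner_integral (lebesgue_on {0<..}) (\<lambda>x. f (c * x)) (I / c)"
proof -
  have sets: "{0<..} \<inter> space lebesgue \<in> sets (lebesgue :: real measure)" by simp
  have "has_bochner_integral lebesgue (\<lambda>x. indicator {0<..} x *\<^sub>R f x) I"
    using assms(1) unfolding has_bochner_integral_restrict_space[OF sets] .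
  then have "has_bochner_integral lebesgue (\<lambda>x. indicator {0<..} (0 + c * x) *\<^sub>R f (0 + c * x)) (I /\<^sub>R \<bar>c\<bar>)"
    using has_bochner_integral_lebesgue_real_affine_iff[of c "\<lambda>x. indicator {0<..} x *\<^sub>R f x" I 0] assms(2)
    by simp
  moreover have "indicator {0<..} (0 + c * x) = (indicator {0<..} x :: real)" for x
    using assms(2) by (simp add: indicator_def zero_less_mult_iff)
  ultimately show ?thesis
    unfolding has_bochner_integral_restrict_space[OF sets]
    using assms(2) by (simp add: divide_inverse mult.commute)
qed

text \<open>The substitution \<open>t = x / (1 + x)\<close> reduces this to the Beta integral on the unit interval, and
  \<open>\<Gamma>(c) \<Gamma>(1 - c)\<close> is given by the reflection formula.\<close>

lemma has_bochner_integral_beta_half_line: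
  fixes c :: real
  assumes c: "0 < c" "c < 1"
  shows "has_bochner_integral (lebesgue_on {0<..}) (\<lambda>x. x powr (c - 1) / (1 + x)) (pi / sin (pi * c))"
proof -
  define f where "f = (\<lambda>t::real. t powr (c - 1) * (1 - t) powr ((1 - c) - 1))"
  define g where "g = (\<lambda>x::real. x / (1 + x))"
  have "(f has_integral Beta c (1 - c)) {0..1}"
    unfolding f_def by (rule has_integral_Beta_real) (use c in auto)
  then have f: "(f has_integral Beta c (1 - c)) {0<..<1}"
    by (simp add: has_integral_Icc_iff_Ioo)
  have "complex_of_real (Gamma c * Gamma (1 - c)) = Gamma (of_real c) * Gamma (of_real (1 - c))"
    by (simp only: Gamma_complex_of_real of_real_mult)
  also have "\<dots> = of_real pi / sin (of_real (pi * c))"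
    using Gamma_reflection_complex[of "of_real c"] by simp
  also have "\<dots> = of_real (pi / sin (pi * c))"
    by (simp only: sin_of_real of_real_divide)
  finally have "Gamma c * Gamma (1 - c) = pi / sin (pi * c)"
    by (simp only: of_real_eq_iff)
  then have B: "Beta c (1 - c) = pi / sin (pi * c)" by (simp add: Beta_def)
  have img: "g ` {0<..} = {0<..<1}"
  proof (intro equalityI subsetI)
    fix t :: real assume "t \<in> {0<..<1}"
    then have "t = g (t / (1 - t))" "t / (1 - t) \<in> {0<..}"
      by (auto simp: g_def field_simps)
    then show "t \<in> g ` {0<..}" by blast
  qed (auto simp: g_def)
  have inj: "inj_on g {0<..}"
  proof (rule inj_onI)
    fix x y :: real assume xy: "x \<in> {0<..}" "y \<in> {0<..}" "g x = g y"
    then have "x * (1 + y) = y * (1 + x)" by (simp add: g_def frac_eq_eq)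
    then show "x = y" by (simp add: algebra_simps)
  qed
  have der: "(g has_field_derivative (1 / (1 + x)\<^sup>2)) (at x within {0<..})" if "x \<in> {0<..}" for x
    unfolding g_def using that
    by (auto intro!: derivative_eq_intros simp: power2_eq_square field_simps)
  have "f absolutely_integrable_on {0<..<1}"
    by (rule nonnegative_absolutely_integrable_1) (use f in \<open>auto simp: f_def\<close>)
  then have "f absolutely_integrable_on (g ` {0<..}) \<and> integral (g ` {0<..}) f = pi / sin (pi * c)"
    unfolding img using integral_unique[OF f] B by simp
  then have "(\<lambda>x. \<bar>1 / (1 + x)\<^sup>2\<bar> * f (g x)) absolutely_integrable_on {0<..} \<and>
      integral {0<..} (\<lambda>x. \<bar>1 / (1 + x)\<^sup>2\<bar> * f (g x)) = pi / sin (pi * c)"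
    by (subst has_absolute_integral_change_of_variables_1'[OF _ der inj]) auto
  then have A: "(\<lambda>x. \<bar>1 / (1 + x)\<^sup>2\<bar> * f (g x)) absolutely_integrable_on {0<..}"
    and I: "integral {0<..} (\<lambda>x. \<bar>1 / (1 + x)\<^sup>2\<bar> * f (g x)) = pi / sin (pi * c)"
    by auto
  have L: "{0<..} \<in> sets (lebesgue :: real measure)" by simp
  have int: "integrable (lebesgue_on {0<..}) (\<lambda>x. \<bar>1 / (1 + x)\<^sup>2\<bar> * f (g x))"
    by (rule absolutely_integrable_imp_integrable[OF A L])
  then have "has_bochner_integral (lebesgue_on {0<..}) (\<lambda>x. \<bar>1 / (1 + x)\<^sup>2\<bar> * f (g x)) (pi / sin (pi * c))"
    unfolding has_bochner_integral_iff using lebesgue_integral_eq_integral[OF int L] I by simp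
  moreover have "\<bar>1 / (1 + x)\<^sup>2\<bar> * f (g x) = x powr (c - 1) / (1 + x)"
    if "x \<in> space (lebesgue_on {0<..})" for x
  proof -
    have x: "x > 0" using that by simp
    have "1 - g x = inverse (1 + x)" using x by (simp add: g_def field_simps)
    then have "f (g x) = x powr (c - 1) / (1 + x) powr (c - 1) * (inverse (1 + x)) powr (- c)"
      using x by (simp add: f_def g_def powr_divide)
    also have "(inverse (1 + x)) powr (- c) = (1 + x) powr c"
      using x by (simp add: powr_minus inverse_powr)
    also have "(1 + x) powr c = (1 + x) powr (c - 1) * (1 + x)"
      using powr_add[of "1 + x" "c - 1" 1] x by simp
    finally have "f (g x) = x powr (c - 1) * (1 + x)" using x by simp
    then show ?thesis using x by (simp add: power2_eq_square)
  qed
  ultimately show ?thesis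
    by (subst has_bochner_integral_cong[OF refl _ refl, of _ _ "\<lambda>x. \<bar>1 / (1 + x)\<^sup>2\<bar> * f (g x)"]) auto
qed

section \<open>The total mass of the weight\<close>

text \<open>The weight of the \<open>q\<close>-Laguerre polynomials without its power of \<open>x\<close>.\<close>

definition qweight :: "real \<Rightarrow> real \<Rightarrow> real" where
  "qweight q x = 1 / qpoch_inf (- x) q"

context
  fixes q :: real
  assumes q: "0 < q" "q < 1"
begin

lemma qweight_nonneg: "0 \<le> x \<Longrightarrow> 0 \<le> qweight q x"
  using qpoch_inf_neg_pos[OF q, of x] by (simp add: qweight_def)

lemma qweight_antimono:
  assumes "0 \<le> x" "x \<le> y"
  shows "qweight q y \<le> qweight q x"
  unfolding qweight_def
  using assms qpoch_inf_neg_mono[OF q assms] qpoch_inf_neg_pos[OF q, of x] qpoch_inf_neg_pos[OF q, of y]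
  by (intro divide_left_mono mult_pos_pos) auto

text \<open>This functional equation is the source of the moment recurrence and of the Frullani form of
  the integral of the weight.\<close>

lemma qweight_scale:
  assumes "0 \<le> x"
  shows "qweight q (q * x) = (1 + x) * qweight q x"
  unfolding qweight_def qpoch_inf_neg_shift[OF q, of x]
  using assms by (simp add: add_nonneg_eq_0_iff)

lemma isCont_qweight:
  assumes "0 \<le> x"
  shows "isCont (qweight q) x"
proof -
  have "isCont (\<lambda>z. qpoch_inf z q) (- x)"
    by (rule isCont_qpoch_inf) (use q in simp)
  then have "isCont (\<lambda>x. qpoch_inf (- x) q) x"
    by (intro isCont_o2[where g = "\<lambda>z. qpoch_inf z q" and f = uminus]) auto
  then show ?thesis
    unfolding qweight_def[abs_def] using qpoch_inf_neg_pos[OF q assms]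
    by (intro continuous_intros) auto
qed

text \<open>The weight equals \<open>(f(qx) - f(x)) / x\<close> for \<open>f\<close> the weight itself.  Hence, if \<open>P\<close> is an
  antiderivative of \<open>f(y)/y\<close>, then \<open>A(x) = P(qx) - P(x)\<close> is an antiderivative of the weight, and by
  the mean value theorem \<open>A(x) = ln q \<cdot> f(c)\<close> for some \<open>c\<close> between \<open>qx\<close> and \<open>x\<close>.  Therefore
  \<open>A\<close> tends to \<open>ln q\<close> at \<open>0\<close> and to \<open>0\<close> at infinity.\<close>

lemma has_bochner_integral_qweight:
  "has_bochner_integral (lebesgue_on {0<..}) (qweight q) (- ln q)"
proof -
  have lnq: "ln q < 0" using q by simp
  define g where "g = (\<lambda>y. qweight q y / y)"
  have "\<exists>P. \<forall>x::real. ereal 0 < ereal x \<longrightarrow> ereal x < \<infinity> \<longrightarrow> (P has_vector_derivative g x) (at x)"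
    by (rule einterval_antiderivative)
       (auto simp: g_def intro!: continuous_intros isCont_qweight)
  then obtain P where P: "\<And>x. x > 0 \<Longrightarrow> (P has_real_derivative g x) (at x)"
    by (auto simp: has_real_derivative_iff_has_vector_derivative)
  define A where "A = (\<lambda>x. P (q * x) - P x)"
  have A': "(A has_real_derivative qweight q x) (at x)" if x: "x > 0" for x
  proof -
    have "((\<lambda>x. P (q * x)) has_real_derivative g (q * x) * q) (at x)"
      by (rule DERIV_chain2[where f = P]) (use P x q in \<open>auto intro!: derivative_eq_intros\<close>)
    then have "(A has_real_derivative g (q * x) * q - g x) (at x)"
      unfolding A_def by (intro DERIV_diff P x)
    moreover have "g (q * x) * q - g x = qweight q x"
      using x q by (simp add: g_def qweight_scale field_simps)
    ultimately show ?thesis by simp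
  qed
  have bounds: "ln q * qweight q (q * x) \<le> A x" "A x \<le> ln q * qweight q x" if x: "x > 0" for x
  proof -
    have qx: "0 < q * x" "q * x < x" using x q by auto
    have "\<exists>c. q * x < c \<and> c < x \<and> (P x - P (q * x)) * (1 / c) = (ln x - ln (q * x)) * g c"
      by (rule GMVT'[OF qx(2)])
         (use qx in \<open>auto intro!: P DERIV_isCont[OF P] derivative_eq_intros continuous_intros\<close>)
    then obtain c where c: "q * x < c" "c < x"
      and eq: "(P x - P (q * x)) * (1 / c) = (ln x - ln (q * x)) * g c" by blast
    have "(P x - P (q * x)) / c = (- ln q * qweight q c) / c"
      using eq x q by (simp add: g_def ln_mult)
    moreover have "c \<noteq> 0" using c qx by auto
    ultimately have "P x - P (q * x) = - ln q * qweight q c" by (simp only: divide_cancel_right) simp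
    then have "A x = ln q * qweight q c" by (simp add: A_def)
    moreover have "qweight q x \<le> qweight q c" "qweight q c \<le> qweight q (q * x)"
      using c qx by (auto intro!: qweight_antimono)
    ultimately show "ln q * qweight q (q * x) \<le> A x" "A x \<le> ln q * qweight q x"
      using lnq by (auto intro: mult_left_mono_neg)
  qed
  have A0: "(A \<longlongrightarrow> ln q) (at_right 0)"
  proof (rule tendsto_sandwich)
    have w0: "qweight q 0 = 1" by (simp add: qweight_def qpoch_inf_0)
    have 1: "(qweight q \<longlongrightarrow> 1) (at_right 0)"
      using isCont_qweight[of 0] w0 by (simp add: isCont_def filterlim_at_split)
    have "isCont (\<lambda>x. qweight q (q * x)) 0"
      by (rule isCont_o2[where g = "qweight q"]) (auto intro!: isCont_qweight)
    then have "((\<lambda>x. qweight q (q * x)) \<longlongrightarrow> 1) (at_right 0)"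
      using w0 by (simp add: isCont_def filterlim_at_split)
    then show "((\<lambda>x. ln q * qweight q (q * x)) \<longlongrightarrow> ln q) (at_right 0)"
      by (auto intro!: tendsto_eq_intros)
    from 1 show "((\<lambda>x. ln q * qweight q x) \<longlongrightarrow> ln q) (at_right 0)"
      by (auto intro!: tendsto_eq_intros)
  qed (use bounds in \<open>auto simp: eventually_at_filter\<close>)
  have Ainf: "(A \<longlongrightarrow> 0) at_top"
  proof (rule tendsto_sandwich)
    have up: "qweight q x \<le> 1 / (1 + x)" if "x > 0" for x
      unfolding qweight_def using qpoch_inf_neg_ge[OF q, of x] that
      by (intro divide_left_mono) (auto intro!: mult_pos_pos)
    have *: "((\<lambda>x. ln q * (1 / (1 + q * x))) \<longlongrightarrow> ln q * 0) at_top"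
      using q by (intro tendsto_mult tendsto_const tendsto_divide_0[OF tendsto_const]
         filterlim_at_top_imp_at_infinity filterlim_tendsto_add_at_top[OF tendsto_const]
         filterlim_tendsto_pos_mult_at_top[OF tendsto_const] filterlim_ident) auto
    then show "((\<lambda>x. ln q * (1 / (1 + q * x))) \<longlongrightarrow> 0) at_top" by simp
    show "\<forall>\<^sub>F x in at_top. ln q * (1 / (1 + q * x)) \<le> A x"
    proof (rule eventually_mono[OF eventually_gt_at_top[of 0]])
      fix x :: real assume x: "0 < x"
      have "ln q * (1 / (1 + q * x)) \<le> ln q * qweight q (q * x)"
        using up[of "q * x"] x q lnq by (intro mult_left_mono_neg) auto
      also have "\<dots> \<le> A x" by (rule bounds(1)[OF x])
      finally show "ln q * (1 / (1 + q * x)) \<le> A x" .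
    qed
    show "\<forall>\<^sub>F x in at_top. A x \<le> 0"
    proof (rule eventually_mono[OF eventually_gt_at_top[of 0]])
      fix x :: real assume x: "0 < x"
      have "ln q * qweight q x \<le> 0"
        using qweight_nonneg[of x] x lnq by (simp add: mult_nonpos_nonneg)
      then show "A x \<le> 0" using bounds(2)[OF x] by simp
    qed
  qed auto
  \<comment> \<open>the improper form of the fundamental theorem, with \<open>A\<close> evaluated at \<open>0\<close> and at infinity\<close>
  have FTC: "set_integrable lborel (einterval (ereal 0) \<infinity>) (qweight q)"
    "(LBINT x=ereal 0..\<infinity>. qweight q x) = 0 - ln q"
    by (rule interval_integral_FTC_nonneg[where F = A];
        use A' isCont_qweight qweight_nonneg A0 Ainf in \<open>auto simp: ereal_tendsto_simps\<close>)+
  define h where "h = (\<lambda>x. indicator {0<..} x *\<^sub>R qweight q x)"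
  have int: "integrable lborel h" and val: "integral\<^sup>L lborel h = - ln q"
    using FTC by (simp_all add: h_def set_integrable_def interval_lebesgue_integral_def set_lebesgue_integral_def)
  have "h \<in> borel_measurable lborel" using int by simp
  then have "has_bochner_integral lebesgue h (- ln q)"
    unfolding has_bochner_integral_iff using int val
    by (simp add: integrable_completion integral_completion)
  then show ?thesis
    by (subst has_bochner_integral_restrict_space) (auto simp: h_def)
qed

end

section \<open>The moments of the weight\<close>

text \<open>For \<open>\<beta> = m \<in> \<nat>\<close> this amounts to splitting \<open>(q;q)\<^bsub>m+n\<^esub>\<close> after \<open>m\<close> or after \<open>n\<close> factors.\<close>

lemma qLaguerre_M_eq_0:
  assumes q: "0 < q" "q < 1" and \<beta>: "\<beta> > -1"
  shows "qLaguerre_M n \<beta> q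
       = qLaguerre_M 0 \<beta> q * (qpoch (q powr (\<beta> + 1)) q n / qpoch q q n)"
proof (cases "\<beta> \<in> \<nat>")
  case True
  then obtain m where m: "\<beta> = real m" by (auto elim: Nats_cases)
  have "norm q < 1" using q by simp
  note nz = qpoch_base_nonzero(3)[OF this]
  have qm: "q powr (\<beta> + 1) = q * q ^ m"
    using q by (simp add: m powr_add powr_realpow)
  have "qpoch q q n * qpoch (q * q ^ n) q m = qpoch q q m * qpoch (q * q ^ m) q n"
    by (metis qpoch_add add.commute)
  then have "qpoch (q * q ^ n) q m = qpoch q q m * (qpoch (q * q ^ m) q n / qpoch q q n)"
    using nz[of n] by (simp add: eq_divide_eq mult.commute)
  then show ?thesis
    unfolding qm by (simp add: qLaguerre_M_def m mult_ac)
qed (simp add: qLaguerre_M_def)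

text \<open>The constant satisfies the recurrence of the moments; for \<open>s \<notin> \<nat>\<close> the sign of
  \<open>1 - q\<^bsup>-s-1\<^esup>\<close> is compensated by the sign change of \<open>sin (\<pi>s)\<close>.\<close>

lemma qLaguerre_M_step:
  assumes q: "0 < q" "q < 1" and s: "s > -1"
  shows "qLaguerre_M 0 (s + 1) q = (q powr (- (s + 1)) - 1) * qLaguerre_M 0 s q"
proof (cases "s \<in> \<nat>")
  case True
  then obtain m where m: "s = real m" by (auto elim: Nats_cases)
  have s1: "s + 1 = real (Suc m)" by (simp add: m)
  define y where "y = q powr (s * (s + 1) / 2)"
  have y: "y > 0" using q by (simp add: y_def)
  have E1: "q powr ((s + 1) * (s + 1 + 1) / 2) = y * q ^ Suc m"
  proof -
    have "(s + 1) * (s + 1 + 1) / 2 = s * (s + 1) / 2 + real (Suc m)"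
      by (simp add: m field_simps)
    then show ?thesis unfolding y_def using q by (simp only: powr_add powr_realpow)
  qed
  have E2: "q powr (- (s + 1)) = 1 / q ^ Suc m"
    unfolding powr_minus s1 using q by (simp only: powr_realpow inverse_eq_divide)
  have E3: "qLaguerre_M 0 (s + 1) q
      = qpoch q q (Suc m) * ln q / q powr ((s + 1) * (s + 1 + 1) / 2)"
    unfolding qLaguerre_M_def s1 by (simp del: of_nat_Suc)
  have E4: "qLaguerre_M 0 s q = qpoch q q m * ln q / y"
    unfolding qLaguerre_M_def y_def m by simp
  show ?thesis
    unfolding E3 E1 E2 E4 qpoch_Suc using q y by (simp add: divide_simps)
next
  case False
  have "s + 1 \<notin> \<nat>"
  proof
    assume "s + 1 \<in> \<nat>"
    then obtain j where j: "s + 1 = real j" by (auto elim: Nats_cases)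
    with s have "j > 0" by (cases j) auto
    then have "s = real (j - 1)" using j by (simp add: of_nat_diff)
    with False show False by simp
  qed
  define y where "y = q powr (- (s + 1))"
  have yq: "q powr (- s) = y * q"
    using q powr_add[of q "- (s + 1)" 1] by (simp add: y_def)
  have y: "qpoch_inf y q = (1 - y) * qpoch_inf (y * q) q"
    using qpoch_inf_split[of q y 1] q by (simp add: qpoch_Suc)
  have sin: "sin (pi * (s + 1)) = - sin (pi * s)"
    by (simp add: distrib_left)
  show ?thesis
    using False \<open>s + 1 \<notin> \<nat>\<close> unfolding qLaguerre_M_def y_def[symmetric] yq sin y
    by (simp add: left_diff_distrib minus_divide_left[symmetric] diff_divide_distrib algebra_simps)
qed

context
  fixes q :: real
  assumes q: "0 < q" "q < 1"
begin

text \<open>Ramanujan's integral in the range in which the partial fractions can be integrated one by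
  one.  The \<open>k\<close>-th one is a rescaled Beta integral and contributes the factor \<open>q\<^bsup>-ck\<^esup>\<close>, so the
  results form Euler's series at \<open>q\<^bsup>1-c\<^esup>\<close>.\<close>

lemma has_bochner_integral_qmoment_fractional:
  assumes c: "0 < c" "c < 1"
  shows "has_bochner_integral (lebesgue_on {0<..}) (\<lambda>x. x powr (c - 1) * qweight q x)
           (pi / sin (pi * c) * qpoch_inf (q powr (1 - c)) q / qpoch_inf q q)"
proof -
  have nq: "norm q < 1" using q by simp
  define e where "e = (\<lambda>k. (-1) ^ k * q ^ (k choose 2) / qpoch q q k)"
  define z where "z = q powr (1 - c)"
  define Q where "Q = qpoch_inf q q"
  define B where "B = pi / sin (pi * c)"
  define b where "b = (\<lambda>k x. (q ^ k * x) powr (c - 1) / (1 + q ^ k * x))"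
  define f where "f = (\<lambda>k x. (e k * z ^ k / Q * q ^ k) * b k x)"
  have Q: "Q \<noteq> 0"
    unfolding Q_def using qpoch_base_nonzero(2)[OF nq] by (intro qpoch_inf_nonzero nq) auto
  have b: "has_bochner_integral (lebesgue_on {0<..}) (b k) (B / q ^ k)" for k
    unfolding b_def B_def
    by (rule has_bochner_integral_half_line_scale[OF has_bochner_integral_beta_half_line[OF c]])
       (use q in simp)
  \<comment> \<open>the coefficient of \<open>b k\<close> contains \<open>z\<^sup>k\<close> in order to cancel \<open>(q\<^sup>k)\<^bsup>c-1\<^esup>\<close>, which the rescaling produces\<close>
  have f_eq: "f k x = x powr (c - 1) / Q * (e k * q ^ k / (1 + x * q ^ k))" if "x > 0" for k x
  proof -
    have "(q ^ k) powr (c - 1) = inverse (z ^ k)"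
      using q powr_minus[of "q ^ k" "1 - c"]
      by (simp add: z_def powr_powr mult.commute flip: powr_realpow)
    then have *: "z ^ k * (q ^ k * x) powr (c - 1) = x powr (c - 1)"
      using q that by (simp add: powr_mult z_def)
    have "f k x = e k / Q * q ^ k / (1 + q ^ k * x) * (z ^ k * (q ^ k * x) powr (c - 1))"
      unfolding f_def b_def by (simp add: mult_ac)
    then have "f k x = e k / Q * q ^ k / (1 + q ^ k * x) * x powr (c - 1)"
      unfolding * .
    then show ?thesis by (simp add: mult_ac)
  qed
  have "has_bochner_integral (lebesgue_on {0<..}) (\<lambda>x. \<Sum>k. f k x) (\<Sum>k. e k * z ^ k * (B / Q))"
  proof (rule has_bochner_integral_suminf(1))
    fix k
    have "has_bochner_integral (lebesgue_on {0<..}) (f k) (e k * z ^ k / Q * q ^ k * (B / q ^ k))"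
      unfolding f_def by (intro has_bochner_integral_mult_right b)
    then show "has_bochner_integral (lebesgue_on {0<..}) (f k) (e k * z ^ k * (B / Q))"
      using q by (simp add: mult_ac)
    have "has_bochner_integral (lebesgue_on {0<..}) (\<lambda>x. norm (e k * z ^ k / Q * q ^ k) * b k x)
        (norm (e k * z ^ k / Q * q ^ k) * (B / q ^ k))"
      by (intro has_bochner_integral_mult_right b)
    moreover have "norm (f k x) = norm (e k * z ^ k / Q * q ^ k) * b k x"
      if "x \<in> space (lebesgue_on {0<..})" for x
      using that q by (simp add: f_def b_def abs_mult abs_divide)
    ultimately have "has_bochner_integral (lebesgue_on {0<..}) (\<lambda>x. norm (f k x))
        (norm (e k * z ^ k / Q * q ^ k) * (B / q ^ k))"
      by (subst has_bochner_integral_cong[OF refl _ refl,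
            of _ _ "\<lambda>x. norm (e k * z ^ k / Q * q ^ k) * b k x"]) auto
    then have "(\<integral>x. norm (f k x) \<partial>lebesgue_on {0<..}) = norm (e k * z ^ k / Q * q ^ k) * (B / q ^ k)"
      by (rule has_bochner_integral_integral_eq)
    then show "(\<integral>x. norm (f k x) \<partial>lebesgue_on {0<..}) \<le> norm (e k * z ^ k) * (B / norm Q)"
      using q by (simp add: abs_mult abs_divide mult_ac)
  next
    show "summable (\<lambda>k. norm (e k * z ^ k) * (B / norm Q))"
      using euler_qpoch_inf(1)[OF nq, of z] unfolding e_def by (rule summable_mult2)
  next
    fix x :: real assume "x \<in> space (lebesgue_on {0<..})"
    then have x: "x > 0" by simp
    have "summable (\<lambda>k. norm (x powr (c - 1) / Q) * norm (e k * q ^ k / (1 + x * q ^ k)))"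
      unfolding e_def by (intro summable_mult partial_fractions_inverse_qpoch_inf(1) q) (use x in simp)
    then show "summable (\<lambda>k. norm (f k x))"
      unfolding f_eq[OF x] norm_mult .
  qed
  moreover have "(\<Sum>k. e k * z ^ k * (B / Q)) = B * qpoch_inf z q / Q"
  proof -
    have "(\<Sum>k. e k * z ^ k * (B / Q)) = (\<Sum>k. e k * z ^ k) * (B / Q)"
      using summable_norm_cancel[OF euler_qpoch_inf(1)[OF nq, of z]] unfolding e_def
      by (rule suminf_mult2[symmetric])
    then show ?thesis using euler_qpoch_inf(2)[OF nq, of z] unfolding e_def by simp
  qed
  moreover have "(\<Sum>k. f k x) = x powr (c - 1) * qweight q x"
    if "x \<in> space (lebesgue_on {0<..})" for x
  proof -
    have x: "x > 0" using that by simp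
    have pos: "qpoch_inf (- x) q > 0" using qpoch_inf_neg_pos[OF q, of x] x by simp
    have "(\<Sum>k. f k x) = x powr (c - 1) / Q * (\<Sum>k. e k * q ^ k / (1 + x * q ^ k))"
      unfolding f_eq[OF x] e_def
      by (rule suminf_mult[OF summable_norm_cancel[OF partial_fractions_inverse_qpoch_inf(1)[OF q]]])
         (use x in simp)
    also have "(\<Sum>k. e k * q ^ k / (1 + x * q ^ k)) = Q * qweight q x"
      using partial_fractions_inverse_qpoch_inf(2)[OF q, of x] x pos
      unfolding e_def Q_def qweight_def by (simp add: eq_divide_eq)
    finally show ?thesis using Q by simp
  qed
  ultimately have "has_bochner_integral (lebesgue_on {0<..}) (\<lambda>x. x powr (c - 1) * qweight q x)
      (B * qpoch_inf z q / Q)"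
    by (subst has_bochner_integral_cong[OF refl _ refl, of _ _ "\<lambda>x. \<Sum>k. f k x"]) auto
  then show ?thesis unfolding B_def z_def Q_def .
qed

text \<open>By \<open>qweight_scale\<close>, \<open>x\<^bsup>s+1\<^esup> w(x) = x\<^sup>s w(qx) - x\<^sup>s w(x)\<close>, and the first term is integrated by
  rescaling.\<close>

lemma has_bochner_integral_qmoment_step:
  assumes "has_bochner_integral (lebesgue_on {0<..}) (\<lambda>x. x powr s * qweight q x) I"
  shows "has_bochner_integral (lebesgue_on {0<..}) (\<lambda>x. x powr (s + 1) * qweight q x)
           ((q powr (- (s + 1)) - 1) * I)"
proof -
  have "has_bochner_integral (lebesgue_on {0<..})
      (\<lambda>x. q powr (- s) * ((q * x) powr s * qweight q (q * x))) (q powr (- s) * (I / q))"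
    by (intro has_bochner_integral_mult_right has_bochner_integral_half_line_scale[OF assms] q)
  then have "has_bochner_integral (lebesgue_on {0<..})
      (\<lambda>x. q powr (- s) * ((q * x) powr s * qweight q (q * x)) - x powr s * qweight q x)
      (q powr (- s) * (I / q) - I)"
    by (rule has_bochner_integral_diff) (rule assms)
  moreover have "q powr (- s) * (I / q) - I = (q powr (- (s + 1)) - 1) * I"
    using q by (simp add: powr_diff left_diff_distrib)
  moreover have "q powr (- s) * ((q * x) powr s * qweight q (q * x)) - x powr s * qweight q x
      = x powr (s + 1) * qweight q x" if "x \<in> space (lebesgue_on {0<..})" for x
  proof -
    have x: "x > 0" using that by simp
    have "q powr (- s) * ((q * x) powr s * qweight q (q * x)) = x powr s * qweight q (q * x)"
      using q x by (simp add: powr_mult powr_minus)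
    then show ?thesis
      using x by (simp add: qweight_scale[OF q] powr_add algebra_simps)
  qed
  ultimately show ?thesis
    by (subst has_bochner_integral_cong[OF refl _ refl, of _ _
          "\<lambda>x. q powr (- s) * ((q * x) powr s * qweight q (q * x)) - x powr s * qweight q x"]) auto
qed

text \<open>Integer steps carry every exponent to one in \<open>]-1, 0]\<close>, where \<open>s = 0\<close> is the Frullani integral
  and \<open>s < 0\<close> Ramanujan's integral with \<open>c = s + 1\<close>.\<close>

theorem has_bochner_integral_qmoment:
  assumes "s > -1"
  shows "has_bochner_integral (lebesgue_on {0<..}) (\<lambda>x. x powr s * qweight q x) (- qLaguerre_M 0 s q)"
proof -
  have base: "has_bochner_integral (lebesgue_on {0<..}) (\<lambda>x. x powr s * qweight q x) (- qLaguerre_M 0 s q)"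
    if s: "-1 < s" "s \<le> 0" for s
  proof (cases "s = 0")
    case True
    have "has_bochner_integral (lebesgue_on {0<..}) (\<lambda>x. x powr 0 * qweight q x) (- ln q)"
      by (subst has_bochner_integral_cong[OF refl _ refl, of _ _ "qweight q"])
         (use has_bochner_integral_qweight[OF q] in auto)
    moreover have "qLaguerre_M 0 0 q = ln q" using q by (simp add: qLaguerre_M_def)
    ultimately show ?thesis by (simp only: True)
  next
    case False
    then have c: "0 < s + 1" "s + 1 < 1" using s by auto
    have "s \<notin> \<nat>" using False s by (auto elim!: Nats_cases)
    have "sin (pi * (s + 1)) = - sin (pi * s)" by (simp add: distrib_left)
    then have "- qLaguerre_M 0 s q
        = pi / sin (pi * (s + 1)) * qpoch_inf (q powr (1 - (s + 1))) q / qpoch_inf q q"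
      using \<open>s \<notin> \<nat>\<close> by (simp add: qLaguerre_M_def)
    then show ?thesis using has_bochner_integral_qmoment_fractional[OF c] by simp
  qed
  have "has_bochner_integral (lebesgue_on {0<..}) (\<lambda>x. x powr (s + real m) * qweight q x)
      (- qLaguerre_M 0 (s + real m) q)" if s: "-1 < s" "s \<le> 0" for s m
  proof (induction m)
    case 0
    then show ?case using base[OF s] by simp
  next
    case (Suc m)
    have e: "s + real (Suc m) = s + real m + 1" by simp
    have "- qLaguerre_M 0 (s + real m + 1) q
        = (q powr (- (s + real m + 1)) - 1) * - qLaguerre_M 0 (s + real m) q"
      using qLaguerre_M_step[OF q, of "s + real m"] s by simp
    then show ?case
      unfolding e using has_bochner_integral_qmoment_step[OF Suc] by (simp only:)
  qed
  note * = this
  define m where "m = nat \<lceil>s\<rceil>"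
  have m: "real m = of_int \<lceil>s\<rceil>" using assms by (simp add: m_def)
  have "-1 < s - real m" "s - real m \<le> 0" using m by linarith+
  from *[OF this, of m] show ?thesis by simp
qed

end

section \<open>Orthogonality of the \<open>q\<close>-Laguerre polynomials\<close>

lemma choose_two_add: "(m + n) choose 2 = (m choose 2) + (n choose 2) + m * n"
  by (induction n) (simp_all add: choose_two_Suc)

lemma qhyper_1_1:
  "qhyper [a] [b] q z = (\<Sum>k. qpoch a q k / (qpoch q q k * qpoch b q k)
      * ((-1) ^ k * q ^ (k choose 2)) * z ^ k)"
  by (simp add: qhyper_def qpochs_def)

lemma qhyper_1_2:
  "qhyper [a] [b, c] q z = (\<Sum>k. qpoch a q k / (qpoch q q k * (qpoch b q k * qpoch c q k))
      * (q ^ (k choose 2))\<^sup>2 * z ^ k)"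
  by (simp add: qhyper_def qpochs_def power_mult_distrib flip: power_mult)

lemma qhyper_2_1:
  "qhyper [a, b] [c] q z = (\<Sum>k. qpoch a q k * qpoch b q k / (qpoch q q k * qpoch c q k) * z ^ k)"
  by (simp add: qhyper_def qpochs_def)

context
  fixes q :: real
  assumes q: "0 < q" "q < 1"
begin

lemma qpoch_powr_nonzero:
  assumes "s > 0"
  shows "q powr s * q ^ k \<noteq> 1" "qpoch (q powr s) q k \<noteq> 0"
proof -
  have *: "q powr s * q ^ k \<noteq> 1" for k
  proof (rule mult_power_neq_1)
    show "norm (q powr s) < 1" using q assms by (simp add: powr_def mult_pos_neg)
  qed (use q in simp)
  show "q powr s * q ^ k \<noteq> 1" by (rule *)
  show "qpoch (q powr s) q k \<noteq> 0" by (rule qpoch_nonzero) (rule *)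
qed

lemma qLaguerre_M_shift:
  assumes "\<beta> > -1"
  shows "qLaguerre_M 0 (\<beta> + real k) q
       = qLaguerre_M 0 \<beta> q * (qpoch (q powr (\<beta> + 1)) q k / ((q powr (\<beta> + 1)) ^ k * q ^ (k choose 2)))"
proof (induction k)
  case (Suc k)
  define B where "B = q powr (\<beta> + 1)"
  have B: "B > 0" using q by (simp add: B_def)
  have "q powr (\<beta> + real k + 1) = B * q ^ k"
    using q by (simp add: B_def algebra_simps flip: powr_realpow powr_add)
  then have "q powr (- (\<beta> + real k + 1)) - 1 = (1 - B * q ^ k) / (B * q ^ k)"
    using q B unfolding powr_minus by (simp add: field_simps)
  moreover have "qLaguerre_M 0 (\<beta> + real (Suc k)) q = qLaguerre_M 0 (\<beta> + real k + 1) q"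
    by (simp add: add_ac)
  ultimately show ?case
    using qLaguerre_M_step[OF q, of "\<beta> + real k"] assms Suc unfolding B_def[symmetric]
    by (simp add: qpoch_Suc choose_two_Suc power_add mult_ac)
qed simp

text \<open>The terminating series written with \<open>(q;q)\<^bsub>n-j\<^esub>\<close> in place of \<open>(q\<^bsup>-n\<^esup>;q)\<^sub>j\<close>, which is the
  shape in which \<open>q_chu_vandermonde\<close> applies.\<close>

lemma qLaguerre_eq_sum:
  assumes "\<beta> > -1"
  shows "qLaguerre n \<beta> q x = (\<Sum>j\<le>n. (-1) ^ j * (q ^ (j choose 2))\<^sup>2 * (q powr (\<beta> + 1)) ^ j
      * qpoch (q powr (\<beta> + 1)) q n
      / (qpoch (q powr (\<beta> + 1)) q j * qpoch q q j * qpoch q q (n - j)) * x ^ j)"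
proof -
  define B where "B = q powr (\<beta> + 1)"
  have nz: "qpoch q q k \<noteq> 0" for k by (rule qpoch_base_nonzero) (use q in simp)
  have nq: "q powr (- real n) = inverse q ^ n"
    using q by (simp add: powr_minus powr_realpow power_inverse)
  have qB: "q powr (real n + \<beta> + 1) = q ^ n * B"
    using q by (simp add: B_def powr_add powr_realpow)
  define c where "c = (\<lambda>k. qpoch (inverse q ^ n) q k / (qpoch q q k * qpoch B q k)
      * ((-1) ^ k * q ^ (k choose 2)) * (- (q ^ n * B) * x) ^ k)"
  have "qhyper [inverse q ^ n] [B] q (- (q ^ n * B) * x) = (\<Sum>k. c k)"
    unfolding c_def by (rule qhyper_1_1)
  also have "\<dots> = (\<Sum>k\<le>n. c k)"
    by (rule suminf_finite) (use q in \<open>auto simp: c_def qpoch_inverse_power_eq_0\<close>)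
  finally have "qLaguerre n \<beta> q x = (\<Sum>k\<le>n. qpoch B q n / qpoch q q n * c k)"
    unfolding qLaguerre_def nq qB B_def[symmetric] by (simp add: sum_distrib_left)
  also have "\<dots> = (\<Sum>j\<le>n. (-1) ^ j * (q ^ (j choose 2))\<^sup>2 * B ^ j * qpoch B q n
      / (qpoch B q j * qpoch q q j * qpoch q q (n - j)) * x ^ j)"
  proof (rule sum.cong)
    fix j assume "j \<in> {..n}"
    then have "qpoch (inverse q ^ n) q j * q ^ (n * j) * qpoch q q (n - j)
       = (-1) ^ j * q ^ (j choose 2) * qpoch q q n"
      using q by (intro qpoch_inverse_power) auto
    then have *: "qpoch (inverse q ^ n) q j * q ^ (n * j)
        = (-1) ^ j * q ^ (j choose 2) * qpoch q q n / qpoch q q (n - j)"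
      using nz[of "n - j"] by (simp add: eq_divide_eq)
    have "(- (q ^ n * B) * x) ^ j = q ^ (n * j) * ((-1) ^ j * B ^ j * x ^ j)"
      by (simp add: power_mult_distrib power_mult power_minus[of "q ^ n * B * x"])
    then have "c j = qpoch (inverse q ^ n) q j * q ^ (n * j) / (qpoch q q j * qpoch B q j)
        * (((-1) ^ j * (-1) ^ j) * q ^ (j choose 2)) * B ^ j * x ^ j"
      unfolding c_def by (simp add: mult_ac)
    also have "(-1 :: real) ^ j * (-1) ^ j = 1" by (simp flip: power_add)
    finally show "qpoch B q n / qpoch q q n * c j = (-1) ^ j * (q ^ (j choose 2))\<^sup>2 * B ^ j * qpoch B q n
      / (qpoch B q j * qpoch q q j * qpoch q q (n - j)) * x ^ j"
      unfolding * using nz[of n] by (simp add: power2_eq_square mult_ac)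
  qed simp
  finally show ?thesis unfolding B_def .
qed

lemma has_bochner_integral_qmoment_power:
  assumes "\<beta> > -1"
  shows "has_bochner_integral (lebesgue_on {0<..}) (\<lambda>x. x ^ k * (x powr \<beta> * qweight q x))
     (- qLaguerre_M 0 (\<beta> + real k) q)"
proof -
  have 1: "has_bochner_integral (lebesgue_on {0<..}) (\<lambda>x. x powr (\<beta> + real k) * qweight q x)
     (- qLaguerre_M 0 (\<beta> + real k) q)"
    by (rule has_bochner_integral_qmoment[OF q]) (use assms in simp)
  have 2: "x powr (\<beta> + real k) * qweight q x = x ^ k * (x powr \<beta> * qweight q x)"
    if "x \<in> space (lebesgue_on {0<..})" for x
  proof -
    have "x powr (\<beta> + real k) = x ^ k * x powr \<beta>"
      using that by (simp add: powr_add powr_realpow mult.commute)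
    then show ?thesis by simp
  qed
  show ?thesis
    by (rule iffD1[OF has_bochner_integral_cong[OF refl 2 refl] 1])
qed

text \<open>Inserting the moments gives a terminating sum of the form of \<open>q_chu_vandermonde\<close> with
  \<open>b = q\<^bsup>\<beta>+1+k\<^esup>\<close> and \<open>d = q\<^bsup>-k\<^esup>\<close>.  As \<open>(q\<^bsup>-k\<^esup>;q)\<^sub>n = 0\<close> for \<open>k < n\<close>, the polynomial is orthogonal to
  all lower powers.\<close>

theorem has_bochner_integral_qLaguerre_power:
  assumes \<beta>: "\<beta> > -1"
  shows "has_bochner_integral (lebesgue_on {0<..})
     (\<lambda>x. x ^ k * qLaguerre n \<beta> q x * (x powr \<beta> * qweight q x))
     (- qLaguerre_M 0 (\<beta> + real k) q * (qpoch (inverse q ^ k) q n / qpoch q q n))"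
proof -
  define B where "B = q powr (\<beta> + 1)"
  have B: "B > 0" using q by (simp add: B_def)
  have Bnz: "qpoch B q j \<noteq> 0" for j
    unfolding B_def by (rule qpoch_powr_nonzero) (use \<beta> in simp)
  have q1: "q ^ Suc j \<noteq> 1" for j
    using q qpoch_base_nonzero[of q] by auto
  define l where "l = (\<lambda>j. (-1) ^ j * (q ^ (j choose 2))\<^sup>2 * B ^ j * qpoch B q n
      / (qpoch B q j * qpoch q q j * qpoch q q (n - j)))"
  define w where "w = (\<lambda>x. x powr \<beta> * qweight q x)"
  define M where "M = qLaguerre_M 0 \<beta> q"
  have L: "qLaguerre n \<beta> q x = (\<Sum>j\<le>n. l j * x ^ j)" for x
    unfolding qLaguerre_eq_sum[OF \<beta>] l_def B_def ..
  have "has_bochner_integral (lebesgue_on {0<..}) (\<lambda>x. \<Sum>j\<le>n. l j * (x ^ (k + j) * w x))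
      (\<Sum>j\<le>n. l j * (- qLaguerre_M 0 (\<beta> + real (k + j)) q))"
    unfolding w_def
    by (intro has_bochner_integral_sum has_bochner_integral_mult_right has_bochner_integral_qmoment_power \<beta>)
  moreover have "(\<Sum>j\<le>n. l j * (x ^ (k + j) * w x)) = x ^ k * qLaguerre n \<beta> q x * w x" for x
    unfolding L by (simp add: sum_distrib_left sum_distrib_right power_add mult_ac)
  moreover have "(\<Sum>j\<le>n. l j * (- qLaguerre_M 0 (\<beta> + real (k + j)) q))
      = - qLaguerre_M 0 (\<beta> + real k) q * (qpoch (inverse q ^ k) q n / qpoch q q n)"
  proof -
    have "(\<Sum>j\<le>n. l j * (- qLaguerre_M 0 (\<beta> + real (k + j)) q))
      = (\<Sum>j\<le>n. - qLaguerre_M 0 (\<beta> + real k) q *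
         ((-1) ^ j * q ^ (j choose 2) * (inverse q ^ k) ^ j * qpoch (B * q ^ k) q j
           * qpoch (B * q ^ k * inverse q ^ k * q ^ j) q (n - j) / (qpoch q q j * qpoch q q (n - j))))"
    proof (rule sum.cong)
      fix j assume "j \<in> {..n}"
      then have n: "qpoch B q n = qpoch B q j * qpoch (B * q ^ j) q (n - j)"
        using qpoch_add[of B q j "n - j"] by simp
      have arg: "B * q ^ k * inverse q ^ k * q ^ j = B * q ^ j"
        using q by (simp add: power_inverse)
      have inv: "(inverse q ^ k) ^ j = inverse (q ^ (k * j))"
        by (simp add: power_inverse power_mult)
      define X1 X2 X3 B1 B2 where X: "X1 = q ^ (j choose 2)" "X2 = q ^ (k choose 2)" "X3 = q ^ (k * j)"
        "B1 = B ^ j" "B2 = B ^ k"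
      have pos: "X1 \<noteq> 0" "X2 \<noteq> 0" "X3 \<noteq> 0" "B1 \<noteq> 0" "B2 \<noteq> 0"
        using q B by (auto simp: X)
      show "l j * (- qLaguerre_M 0 (\<beta> + real (k + j)) q) = - qLaguerre_M 0 (\<beta> + real k) q *
         ((-1) ^ j * q ^ (j choose 2) * (inverse q ^ k) ^ j * qpoch (B * q ^ k) q j
           * qpoch (B * q ^ k * inverse q ^ k * q ^ j) q (n - j) / (qpoch q q j * qpoch q q (n - j)))"
        unfolding arg inv l_def n qLaguerre_M_shift[OF \<beta>] B_def[symmetric] choose_two_add qpoch_add
          power_add M_def[symmetric] power2_eq_square X[symmetric]
        using pos Bnz[of j] by (simp add: divide_simps)
    qed simp
    also have "\<dots> = - qLaguerre_M 0 (\<beta> + real k) q * (qpoch (inverse q ^ k) q n / qpoch q q n)"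
      by (subst sum_distrib_left[symmetric], subst q_chu_vandermonde[OF q1]) (rule refl)
    finally show ?thesis .
  qed
  ultimately show ?thesis unfolding w_def by simp
qed

end

section \<open>Termwise integration of the \<open>q\<close>-hypergeometric series\<close>

text \<open>The polynomial is bounded by its coefficients in absolute value; since these do not depend on
  \<open>k\<close>, the bound suffices for the summability needed to integrate a series in \<open>x\<^sup>k\<close> termwise.\<close>

lemma norm_qLaguerre_integrand_bound:
  assumes q: "0 < q" "q < 1" and \<beta>: "\<beta> > -1"
  obtains l :: "nat \<Rightarrow> real" where "\<And>j. l j \<ge> 0"
    "\<And>k. (\<integral>x. norm (x ^ k * qLaguerre n \<beta> q x * (x powr \<beta> * qweight q x)) \<partial>lebesgue_on {0<..})
        \<le> (\<Sum>j\<le>n. l j * norm (qLaguerre_M 0 (\<beta> + real (k + j)) q))"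
proof -
  obtain c :: "nat \<Rightarrow> real" where c: "\<And>x. qLaguerre n \<beta> q x = (\<Sum>j\<le>n. c j * x ^ j)"
    by (rule that) (rule qLaguerre_eq_sum[OF q \<beta>])
  define w where "w = (\<lambda>x. x powr \<beta> * qweight q x)"
  have "(\<integral>x. norm (x ^ k * qLaguerre n \<beta> q x * w x) \<partial>lebesgue_on {0<..})
        \<le> (\<Sum>j\<le>n. \<bar>c j\<bar> * norm (qLaguerre_M 0 (\<beta> + real (k + j)) q))" for k
  proof -
    have hbi: "has_bochner_integral (lebesgue_on {0<..}) (\<lambda>x. \<Sum>j\<le>n. \<bar>c j\<bar> * (x ^ (k + j) * w x))
        (\<Sum>j\<le>n. \<bar>c j\<bar> * (- qLaguerre_M 0 (\<beta> + real (k + j)) q))"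
      unfolding w_def
      by (intro has_bochner_integral_sum has_bochner_integral_mult_right
            has_bochner_integral_qmoment_power q \<beta>)
    have "(\<integral>x. norm (x ^ k * qLaguerre n \<beta> q x * w x) \<partial>lebesgue_on {0<..})
        \<le> (\<integral>x. (\<Sum>j\<le>n. \<bar>c j\<bar> * (x ^ (k + j) * w x)) \<partial>lebesgue_on {0<..})"
    proof (rule integral_mono)
      show "integrable (lebesgue_on {0<..}) (\<lambda>x. norm (x ^ k * qLaguerre n \<beta> q x * w x))"
        using has_bochner_integral_qLaguerre_power[OF q \<beta>, of k n] unfolding w_def
        by (intro integrable_norm) (auto simp: has_bochner_integral_iff)
      show "integrable (lebesgue_on {0<..}) (\<lambda>x. \<Sum>j\<le>n. \<bar>c j\<bar> * (x ^ (k + j) * w x))"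
        using hbi by (auto simp: has_bochner_integral_iff)
      fix x :: real assume "x \<in> space (lebesgue_on {0<..})"
      then have x: "x > 0" by simp
      then have w: "w x \<ge> 0" unfolding w_def using qweight_nonneg[OF q, of x] by simp
      have "norm (x ^ k * qLaguerre n \<beta> q x * w x) = x ^ k * \<bar>\<Sum>j\<le>n. c j * x ^ j\<bar> * w x"
        using x w by (simp add: abs_mult c)
      also have "\<dots> \<le> x ^ k * (\<Sum>j\<le>n. \<bar>c j * x ^ j\<bar>) * w x"
        using x w by (intro mult_right_mono mult_left_mono sum_abs) auto
      also have "\<dots> = (\<Sum>j\<le>n. \<bar>c j\<bar> * (x ^ (k + j) * w x))"
        using x by (simp add: sum_distrib_left sum_distrib_right power_add abs_mult mult_ac)
      finally show "norm (x ^ k * qLaguerre n \<beta> q x * w x) \<le> (\<Sum>j\<le>n. \<bar>c j\<bar> * (x ^ (k + j) * w x))" .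
    qed
    also have "\<dots> = (\<Sum>j\<le>n. \<bar>c j\<bar> * (- qLaguerre_M 0 (\<beta> + real (k + j)) q))"
      using hbi by (rule has_bochner_integral_integral_eq)
    also have "\<dots> \<le> (\<Sum>j\<le>n. \<bar>c j\<bar> * norm (qLaguerre_M 0 (\<beta> + real (k + j)) q))"
      by (intro sum_mono mult_left_mono) auto
    finally show ?thesis .
  qed
  then show ?thesis
    by (intro that[of "\<lambda>j. \<bar>c j\<bar>"]) (auto simp: w_def)
qed

text \<open>With \<open>k = m + n\<close>, \<open>A = q\<^bsup>\<alpha>+1\<^esup>\<close>, \<open>B = q\<^bsup>\<beta>+1\<^esup>\<close> and \<open>r = q\<^bsup>\<alpha>-\<beta>\<^esup>\<close>, the left-hand side is the \<open>k\<close>-th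
  coefficient of the \<open>\<^sub>1\<phi>\<^sub>2\<close> series multiplied by the integral of \<open>x\<^sup>k L\<^sub>n w\<close>, and the right-hand side
  is a constant times the \<open>m\<close>-th term of a \<open>\<^sub>2\<phi>\<^sub>2\<close> series.  Every factor splits at \<open>n\<close>, and the
  powers of \<open>q\<close> combine because \<open>k(k-1)/2 + n(n-1)/2 - nk = m(m-1)/2 - n\<close>.\<close>

lemma coefficient_identity:
  fixes q t A B r \<gamma> M :: "'a :: real_normed_field"
  assumes q: "norm q < 1" "q \<noteq> 0" and B: "B \<noteq> 0" and A: "A = r * B"
    and A1: "\<And>k. A * q ^ k \<noteq> 1" and g1: "\<And>k. \<gamma> * t * q ^ k \<noteq> 1"
  shows "qpoch \<gamma> q (m + n) / (qpoch q q (m + n) * (qpoch A q (m + n) * qpoch (\<gamma> * t) q (m + n)))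
        * (q ^ ((m + n) choose 2))\<^sup>2 * (- (t * A)) ^ (m + n)
      * (- (M * (qpoch B q (m + n) / (B ^ (m + n) * q ^ ((m + n) choose 2))))
          * (qpoch (inverse q ^ (m + n)) q n / qpoch q q n))
    = - ((t * r) ^ n * qpoch \<gamma> q n) / (q ^ n * qpoch (\<gamma> * t) q n * qpoch A q n)
       * (M * (qpoch B q n / qpoch q q n))
       * (qpoch (\<gamma> * q ^ n) q m * qpoch (B * q ^ n) q m
          / (qpoch q q m * qpoch (A * q ^ n) q m * qpoch (\<gamma> * t * q ^ n) q m)
          * ((-1) ^ m * q ^ (m choose 2)) * (r * t) ^ m)"
proof -
  have nz: "qpoch q q k \<noteq> 0" for k by (rule qpoch_base_nonzero[OF q(1)])
  have A_nz: "qpoch A q k \<noteq> 0" for k by (rule qpoch_nonzero[OF A1])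
  have g_nz: "qpoch (\<gamma> * t) q k \<noteq> 0" for k by (rule qpoch_nonzero[OF g1])
  \<comment> \<open>names for the powers that occur, so that the final step is an identity between rational functions\<close>
  define X Y Z W where X: "X = q ^ (n choose 2)" and Y: "Y = q ^ (m choose 2)"
    and Z: "Z = q ^ (n * m)" and W: "W = q ^ n"
  have XYZ: "X \<noteq> 0" "Y \<noteq> 0" "Z \<noteq> 0" "W \<noteq> 0" using q by (auto simp: X Y Z W)
  have c: "q ^ ((m + n) choose 2) = X * Y * Z"
    by (simp add: choose_two_add power_add X Y Z mult_ac)
  have "n * n = (n choose 2) + (n choose 2) + n"
    by (induction n) (simp_all add: choose_two_Suc)
  then have "(m + n) * n = (n choose 2) + (n choose 2) + n + n * m"
    by (simp only: distrib_right mult.commute[of m n] add.commute)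
  then have e: "q ^ ((m + n) * n) = X * X * W * Z"
    by (simp only: X Z W power_add)
  define N where "N = qpoch q q (m + n)"
  have N: "N \<noteq> 0" unfolding N_def by (rule nz)
  have "qpoch (inverse q ^ (m + n)) q n * q ^ ((m + n) * n) * qpoch q q m = (-1) ^ n * X * N"
    using qpoch_inverse_power[OF q(2), of n "m + n"] unfolding N_def X by simp
  then have inv: "qpoch (inverse q ^ (m + n)) q n = (-1) ^ n * N / (X * W * Z * qpoch q q m)"
    unfolding e using XYZ nz[of m] by (simp add: field_simps)
  have s: "(- (t * A)) ^ (m + n) = (-1) ^ m * (-1) ^ n * (t * r) ^ n * (r * t) ^ m * B ^ (m + n)"
  proof -
    have "- (t * A) = (-1) * (t * r) * B" by (simp add: A)
    then show ?thesis
      by (simp only: power_mult_distrib power_add mult_ac)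
  qed
  have sign: "(-1 :: 'a) ^ n * (-1) ^ n = 1" by (simp flip: power_add)
  have split: "qpoch a q (m + n) = qpoch a q n * qpoch (a * q ^ n) q m" for a
    by (subst add.commute) (rule qpoch_add)
  have sp_nz: "qpoch (A * q ^ n) q m \<noteq> 0" "qpoch (\<gamma> * t * q ^ n) q m \<noteq> 0"
    using A_nz[of "m + n"] g_nz[of "m + n"] unfolding split by auto
  define K where "K = B ^ (m + n)"
  have K: "K \<noteq> 0" using B by (simp add: K_def)
  define u where "u = (-1 :: 'a) ^ n"
  have u: "u * u = 1" using sign by (simp add: u_def)
  show ?thesis
    unfolding inv c s N_def[symmetric] K_def[symmetric] u_def[symmetric]
    unfolding split[of \<gamma>] split[of A] split[of "\<gamma> * t"] split[of B]
    unfolding Y[symmetric] W[symmetric] power2_eq_square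
    using u XYZ K N nz[of m] nz[of n] A_nz[of n] g_nz[of n] sp_nz[unfolded W[symmetric]]
    by (simp add: divide_simps)
qed

theorem corollary27:
  fixes n :: nat and \<alpha> \<beta> q :: real and \<gamma> t :: complex
  assumes "\<alpha> > -1" and "\<beta> > -1"
    and "0 < q" and "q < 1"
    and "norm t < 1 - q"
    and "\<forall>k::nat. \<gamma> * t * of_real q ^ k \<noteq> 1"
  shows "has_bochner_integral (lebesgue_on {0<..})
     (\<lambda>x::real.
        qhyper [\<gamma>] [of_real (q powr (\<alpha> + 1)), \<gamma> * t] (of_real q)
               (- of_real x * t * of_real (q powr (\<alpha> + 1)))
        * of_real (qLaguerre n \<beta> q x)
        * of_real (x powr \<beta> / qpoch_inf (- x) q))
     (- ((t * of_real (q powr (\<alpha> - \<beta>))) ^ n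
           * qpoch_inf t (of_real q) * qpoch \<gamma> (of_real q) n)
        / (of_real q ^ n * qpoch_inf (\<gamma> * t) (of_real q)
             * qpoch (of_real (q powr (\<alpha> + 1))) (of_real q) n)
        * qhyper [of_real (q powr (\<alpha> - \<beta>)), \<gamma> * of_real q ^ n]
                 [of_real (q powr (\<alpha> + real n + 1))] (of_real q) t
        * of_real (qLaguerre_M n \<beta> q))"
proof -
  note q = assms(3,4) and \<beta> = assms(2)
  define p :: complex where "p = of_real q"
  define A :: complex where "A = of_real (q powr (\<alpha> + 1))"
  define B :: complex where "B = of_real (q powr (\<beta> + 1))"
  define r :: complex where "r = of_real (q powr (\<alpha> - \<beta>))"
  define M :: complex where "M = of_real (qLaguerre_M 0 \<beta> q)"
  have p: "norm p < 1" "p \<noteq> 0" using q by (simp_all add: p_def)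
  have B0: "B \<noteq> 0" using q by (simp add: B_def)
  have ArB: "A = r * B"
  proof -
    have "q powr (\<alpha> + 1) = q powr (\<alpha> - \<beta>) * q powr (\<beta> + 1)"
      by (simp flip: powr_add)
    then show ?thesis by (simp add: A_def r_def B_def)
  qed
  have t: "norm t < 1" using assms(5) q by simp
  have A1: "A * p ^ k \<noteq> 1" for k
  proof -
    have "q powr (\<alpha> + 1) * q ^ k \<noteq> 1" by (rule qpoch_powr_nonzero(1)[OF q]) (use assms(1) in simp)
    moreover have "A * p ^ k = of_real (q powr (\<alpha> + 1) * q ^ k)" by (simp add: A_def p_def)
    ultimately show ?thesis by (metis of_real_eq_1_iff)
  qed
  have g1: "\<gamma> * t * p ^ k \<noteq> 1" for k using assms(6) by (simp add: p_def)
  define c where "c = (\<lambda>k. qpoch \<gamma> p k / (qpoch p p k * (qpoch A p k * qpoch (\<gamma> * t) p k))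
      * (p ^ (k choose 2))\<^sup>2 * (- (t * A)) ^ k)"
  define mu where "mu = (\<lambda>k. M * (qpoch B p k / (B ^ k * p ^ (k choose 2))))"
  have mu: "of_real (qLaguerre_M 0 (\<beta> + real k) q) = mu k" for k
    unfolding qLaguerre_M_shift[OF q \<beta>]
    by (simp add: mu_def M_def B_def p_def qpoch_of_real)
  define g where "g = (\<lambda>k x. x ^ k * qLaguerre n \<beta> q x * (x powr \<beta> * qweight q x))"
  define I where "I = (\<lambda>k. c k * (- mu k * (qpoch (inverse p ^ k) p n / qpoch p p n)))"

  have c_ratio: "c (Suc k) = ((1 - \<gamma> * p ^ k) * (p ^ k)\<^sup>2 * (- (t * A))
      / ((1 - p * p ^ k) * (1 - A * p ^ k) * (1 - \<gamma> * t * p ^ k))) * c k" for k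
    unfolding c_def qpoch_Suc choose_two_Suc
    by (simp add: power_add power_mult_distrib mult_ac)
  have c_summable: "summable (\<lambda>k. norm (c k * y ^ k))" for y
  proof (rule ratio_limit_summable)
    fix k
    show "c (Suc k) * y ^ Suc k = ((1 - \<gamma> * p ^ k) * (p ^ k)\<^sup>2 * (- (t * A))
      / ((1 - p * p ^ k) * (1 - A * p ^ k) * (1 - \<gamma> * t * p ^ k)) * y) * (c k * y ^ k)"
      unfolding c_ratio by simp
    have "(\<lambda>k. (1 - \<gamma> * p ^ k) * (p ^ k)\<^sup>2 * (- (t * A))
      / ((1 - p * p ^ k) * (1 - A * p ^ k) * (1 - \<gamma> * t * p ^ k)) * y) \<longlonglongrightarrow>
      (1 - 0) * 0\<^sup>2 * (- (t * A)) / ((1 - 0) * (1 - 0) * (1 - 0)) * y"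
      by (intro tendsto_intros power_LIMSEQ_zero p) simp
    then show "(\<lambda>k. (1 - \<gamma> * p ^ k) * (p ^ k)\<^sup>2 * (- (t * A))
      / ((1 - p * p ^ k) * (1 - A * p ^ k) * (1 - \<gamma> * t * p ^ k)) * y) \<longlonglongrightarrow> 0" by simp
  qed simp
  \<comment> \<open>in the quotient one of the two factors \<open>q\<^sup>k\<close> of the series survives the growth of the moments\<close>
  have c_mu_summable: "summable (\<lambda>k. norm (c k * mu (k + j)))" for j
  proof (rule ratio_limit_summable)
    fix k
    have mu_ratio: "mu (Suc (k + j)) = ((1 - B * p ^ (k + j)) / (B * p ^ (k + j))) * mu (k + j)"
      unfolding mu_def qpoch_Suc choose_two_Suc by (simp add: power_add mult_ac)
    show "c (Suc k) * mu (Suc k + j) = ((1 - \<gamma> * p ^ k) * p ^ k * (- (t * A)) * (1 - B * p ^ j * p ^ k)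
      / ((1 - p * p ^ k) * (1 - A * p ^ k) * (1 - \<gamma> * t * p ^ k) * (B * p ^ j))) * (c k * mu (k + j))"
      unfolding c_ratio add_Suc mu_ratio using p(2) B0
      by (simp add: power_add power2_eq_square mult_ac)
    have "(\<lambda>k. (1 - \<gamma> * p ^ k) * p ^ k * (- (t * A)) * (1 - B * p ^ j * p ^ k)
      / ((1 - p * p ^ k) * (1 - A * p ^ k) * (1 - \<gamma> * t * p ^ k) * (B * p ^ j))) \<longlonglongrightarrow>
      (1 - 0) * 0 * (- (t * A)) * (1 - 0) / ((1 - 0) * (1 - 0) * (1 - 0) * (B * p ^ j))"
      using p(2) B0 by (intro tendsto_intros power_LIMSEQ_zero p) simp
    then show "(\<lambda>k. (1 - \<gamma> * p ^ k) * p ^ k * (- (t * A)) * (1 - B * p ^ j * p ^ k)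
      / ((1 - p * p ^ k) * (1 - A * p ^ k) * (1 - \<gamma> * t * p ^ k) * (B * p ^ j))) \<longlonglongrightarrow> 0" by simp
  qed simp

  obtain l :: "nat \<Rightarrow> real" where l: "\<And>j. l j \<ge> 0" and
    l_bound: "\<And>k. (\<integral>x. norm (g k x) \<partial>lebesgue_on {0<..})
        \<le> (\<Sum>j\<le>n. l j * norm (qLaguerre_M 0 (\<beta> + real (k + j)) q))"
    using norm_qLaguerre_integrand_bound[OF q \<beta>, of n] unfolding g_def by blast
  have HBI: "has_bochner_integral (lebesgue_on {0<..}) (\<lambda>x. \<Sum>k. c k * of_real (g k x)) (\<Sum>k. I k)"
    and I_summable: "summable I"
  proof -
    have 1: "has_bochner_integral (lebesgue_on {0<..}) (\<lambda>x. c k * of_real (g k x)) (I k)" for k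
    proof -
      have "has_bochner_integral (lebesgue_on {0<..}) (\<lambda>x. complex_of_real (g k x))
        (of_real (- qLaguerre_M 0 (\<beta> + real k) q * (qpoch (inverse q ^ k) q n / qpoch q q n)))"
        unfolding g_def
        by (intro has_bochner_integral_of_real has_bochner_integral_qLaguerre_power q \<beta>)
      moreover have "complex_of_real (- qLaguerre_M 0 (\<beta> + real k) q * (qpoch (inverse q ^ k) q n / qpoch q q n))
        = - mu k * (qpoch (inverse p ^ k) p n / qpoch p p n)"
        unfolding mu[symmetric] p_def
        by (simp flip: qpoch_of_real)
      ultimately show ?thesis unfolding I_def by (intro has_bochner_integral_mult_right) simp
    qed
    have 2: "summable (\<lambda>k. norm (c k * complex_of_real (g k x)))" if "x \<in> space (lebesgue_on {0<..})" for x
    proof -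
      have "summable (\<lambda>k. norm (c k * of_real x ^ k) * norm (qLaguerre n \<beta> q x * (x powr \<beta> * qweight q x)))"
        by (intro summable_mult2 c_summable)
      then show ?thesis by (simp add: g_def norm_mult abs_mult norm_power mult_ac)
    qed
    have 3: "(\<integral>x. norm (c k * complex_of_real (g k x)) \<partial>lebesgue_on {0<..})
        \<le> (\<Sum>j\<le>n. l j * norm (c k * mu (k + j)))" for k
    proof -
      have "(\<integral>x. norm (c k * complex_of_real (g k x)) \<partial>lebesgue_on {0<..})
          = norm (c k) * (\<integral>x. norm (g k x) \<partial>lebesgue_on {0<..})"
        by (simp add: norm_mult)
      also have "\<dots> \<le> norm (c k) * (\<Sum>j\<le>n. l j * norm (qLaguerre_M 0 (\<beta> + real (k + j)) q))"
        by (intro mult_left_mono l_bound) simp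
      also have "\<dots> = (\<Sum>j\<le>n. l j * norm (c k * mu (k + j)))"
        unfolding mu[symmetric] by (simp add: sum_distrib_left norm_mult mult_ac)
      finally show ?thesis .
    qed
    have 4: "summable (\<lambda>k. \<Sum>j\<le>n. l j * norm (c k * mu (k + j)))"
      by (intro summable_sum summable_mult c_mu_summable)
    show "has_bochner_integral (lebesgue_on {0<..}) (\<lambda>x. \<Sum>k. c k * of_real (g k x)) (\<Sum>k. I k)"
      and "summable I"
      using has_bochner_integral_suminf[OF 1 2 3 4] by blast+
  qed

  have integrand: "qhyper [\<gamma>] [A, \<gamma> * t] p (- of_real x * t * A) * of_real (qLaguerre n \<beta> q x)
        * of_real (x powr \<beta> / qpoch_inf (- x) q) = (\<Sum>k. c k * of_real (g k x))" for x
  proof -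
    define v where "v = complex_of_real (qLaguerre n \<beta> q x) * of_real (x powr \<beta> / qpoch_inf (- x) q)"
    have arg: "- of_real x * t * A = - (t * A) * of_real x" by simp
    have "qhyper [\<gamma>] [A, \<gamma> * t] p (- of_real x * t * A) = (\<Sum>k. c k * of_real x ^ k)"
      unfolding qhyper_1_2 c_def arg power_mult_distrib by (simp add: mult_ac)
    then have "qhyper [\<gamma>] [A, \<gamma> * t] p (- of_real x * t * A) * v = (\<Sum>k. c k * of_real x ^ k * v)"
      using suminf_mult2[OF summable_norm_cancel[OF c_summable]] by simp
    then show ?thesis
      by (simp add: v_def g_def qweight_def mult_ac)
  qed

  define Phi where "Phi = (\<Sum>m. qpoch (\<gamma> * p ^ n) p m * qpoch (B * p ^ n) p m
          / (qpoch p p m * qpoch (A * p ^ n) p m * qpoch (\<gamma> * t * p ^ n) p m)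
          * ((-1) ^ m * p ^ (m choose 2)) * (r * t) ^ m)"
  define C where "C = - ((t * r) ^ n * qpoch \<gamma> p n) / (p ^ n * qpoch (\<gamma> * t) p n * qpoch A p n)
       * (M * (qpoch B p n / qpoch p p n))"
  have "(\<Sum>k. I k) = (\<Sum>m. I (m + n)) + (\<Sum>k<n. I k)"
    by (rule suminf_split_initial_segment[OF I_summable])
  \<comment> \<open>orthogonality to the powers below \<open>n\<close>\<close>
  also have "(\<Sum>k<n. I k) = 0"
    using p(2) by (intro sum.neutral) (auto simp: I_def qpoch_inverse_power_eq_0)
  also have "(\<Sum>m. I (m + n)) + 0 = C * Phi"
  proof -
    define T where "T = (\<lambda>m. qpoch (\<gamma> * p ^ n) p m * qpoch (B * p ^ n) p m
          / (qpoch p p m * qpoch (A * p ^ n) p m * qpoch (\<gamma> * t * p ^ n) p m)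
          * ((-1) ^ m * p ^ (m choose 2)) * (r * t) ^ m)"
    have I_T: "I (m + n) = C * T m" for m
      unfolding I_def c_def mu_def C_def T_def
      by (rule coefficient_identity) (use p B0 ArB A1 g1 in auto)
    have "summable T"
    proof (rule summable_norm_cancel, rule ratio_limit_summable)
      fix m
      show "T (Suc m) = (- ((1 - \<gamma> * p ^ n * p ^ m) * (1 - B * p ^ n * p ^ m) * p ^ m * (r * t))
          / ((1 - p * p ^ m) * (1 - A * p ^ n * p ^ m) * (1 - \<gamma> * t * p ^ n * p ^ m))) * T m"
        unfolding T_def qpoch_Suc choose_two_Suc by (simp add: power_add mult_ac)
      have "(\<lambda>m. - ((1 - \<gamma> * p ^ n * p ^ m) * (1 - B * p ^ n * p ^ m) * p ^ m * (r * t))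
          / ((1 - p * p ^ m) * (1 - A * p ^ n * p ^ m) * (1 - \<gamma> * t * p ^ n * p ^ m)))
        \<longlonglongrightarrow> - ((1 - 0) * (1 - 0) * 0 * (r * t)) / ((1 - 0) * (1 - 0) * (1 - 0))"
        by (intro tendsto_intros power_LIMSEQ_zero p) simp
      then show "(\<lambda>m. - ((1 - \<gamma> * p ^ n * p ^ m) * (1 - B * p ^ n * p ^ m) * p ^ m * (r * t))
          / ((1 - p * p ^ m) * (1 - A * p ^ n * p ^ m) * (1 - \<gamma> * t * p ^ n * p ^ m))) \<longlonglongrightarrow> 0" by simp
    qed simp
    then show ?thesis unfolding I_T Phi_def T_def[symmetric] by (simp add: suminf_mult)
  qed
  also have "C * Phi = - ((t * r) ^ n * qpoch_inf t p * qpoch \<gamma> p n)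
        / (p ^ n * qpoch_inf (\<gamma> * t) p * qpoch A p n)
        * qhyper [r, \<gamma> * p ^ n] [of_real (q powr (\<alpha> + real n + 1))] p t * of_real (qLaguerre_M n \<beta> q)"
  proof -
    have An: "of_real (q powr (\<alpha> + real n + 1)) = r * (B * p ^ n)"
    proof -
      have "q powr (\<alpha> + real n + 1) = q powr (\<alpha> + 1) * q ^ n"
        using q by (simp add: algebra_simps flip: powr_realpow powr_add)
      then show ?thesis using ArB by (simp add: A_def p_def)
    qed
    have A2: "A * p ^ n = r * (B * p ^ n)" by (simp add: ArB)
    have gt: "\<gamma> * p ^ n * t = \<gamma> * t * p ^ n" by simp
    \<comment> \<open>Jackson's transformation with \<open>a = \<gamma>q\<^sup>n\<close>, \<open>b = q\<^bsup>\<alpha>-\<beta>\<^esup>\<close>, \<open>d = q\<^bsup>\<beta>+1+n\<^esup>\<close> and \<open>z = t\<close>\<close>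
    have "(\<Sum>k. qpoch (\<gamma> * p ^ n) p k * qpoch r p k / (qpoch p p k * qpoch (r * (B * p ^ n)) p k) * t ^ k)
        * qpoch_inf t p = qpoch_inf (\<gamma> * p ^ n * t) p * Phi"
      unfolding Phi_def A2 gt[symmetric]
    proof (rule jackson_transformation)
      show "r * (B * p ^ n) * p ^ k \<noteq> 1" for k
        using A1[of "n + k"] by (simp add: ArB power_add mult_ac)
      show "\<gamma> * p ^ n * t * p ^ k \<noteq> 1" for k
        using g1[of "n + k"] by (simp add: power_add mult_ac)
    qed (use p t in auto)
    then have J: "qhyper [r, \<gamma> * p ^ n] [of_real (q powr (\<alpha> + real n + 1))] p t * qpoch_inf t p
        = qpoch_inf (\<gamma> * t * p ^ n) p * Phi"
      unfolding qhyper_2_1 An gt by (simp add: mult.commute)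
    have g_inf: "qpoch_inf (\<gamma> * t) p = qpoch (\<gamma> * t) p n * qpoch_inf (\<gamma> * t * p ^ n) p"
      by (rule qpoch_inf_split[OF p(1)])
    have "qpoch_inf (\<gamma> * t) p \<noteq> 0" by (rule qpoch_inf_nonzero[OF p(1) g1])
    then have g_inf_nz: "qpoch_inf (\<gamma> * t * p ^ n) p \<noteq> 0" unfolding g_inf by simp
    have Phi: "Phi = qhyper [r, \<gamma> * p ^ n] [of_real (q powr (\<alpha> + real n + 1))] p t * qpoch_inf t p
        / qpoch_inf (\<gamma> * t * p ^ n) p"
      unfolding J using g_inf_nz by simp
    have Mn: "of_real (qLaguerre_M n \<beta> q) = M * (qpoch B p n / qpoch p p n)"
      unfolding qLaguerre_M_eq_0[OF q \<beta>, of n]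
      by (simp add: M_def B_def p_def qpoch_of_real)
    show ?thesis
      unfolding C_def Phi Mn g_inf by (simp add: mult_ac)
  qed
  finally have "(\<Sum>k. I k) = - ((t * r) ^ n * qpoch_inf t p * qpoch \<gamma> p n)
        / (p ^ n * qpoch_inf (\<gamma> * t) p * qpoch A p n)
        * qhyper [r, \<gamma> * p ^ n] [of_real (q powr (\<alpha> + real n + 1))] p t * of_real (qLaguerre_M n \<beta> q)" .
  with HBI show ?thesis
    unfolding integrand[symmetric] p_def A_def r_def by simp
qed

end
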